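(* A subset $M\subset\widetilde{AG}_1(3)$ is the set of fibers of a $(1,3)$-fibration if and only if there exist a copy of $\mathbb R^2$ in $\mathbb R^3$ (an affine $2$-plane with a choice of origin, orthonormal coordinates and unit normal, giving a Euclidean identification of $\mathbb R^3$ with $\mathbb R^2\times\mathbb R$) and a continuous map $B:\mathbb R^2\to\mathbb R^2$ with $B(0)=0$, such that $M$ consists precisely of the graphs of the functions $t\mapsto B(y)t+y$, $y\in\mathbb R^2$, and the following two properties hold: (1) for all distinct $y,z\in\mathbb R^2$, $\operatorname{Ker}(A(y)-A(z))=0$, where $A(y)$ is the $2\times2$ matrix with columns $B(y)$ and $y$; (2) if $\{y_n\}\subset\mathbb R^2$ is a sequence with no accumulation points and $\ell_n$ denotes the fiber (graph) through $y_n$, then $|\ell_n|\to\infty$. Moreover, for a $(1,3)$-fibration with such a map $B$, the fibration corresponds via central projection to a fibration of $S^3$ by oriented great circles if and only if $B$ is surjective.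
   Context: $\widetilde{AG}_1(3)$ is the space of oriented affine lines in $\mathbb R^3$. A $(1,3)$-fibration is a continuous fibration of $\mathbb R^3$ by pairwise skew oriented lines (fibers): through every point passes exactly one line, the map $V:\mathbb R^3\to S^2$ sending a point to the unit oriented direction of the line through it is continuous, and any two distinct lines are disjoint and non-parallel. The graph of $t\mapsto B(y)t+y$ is the line $\{(B(y)t+y,\,t): t\in\mathbb R\}\subset\mathbb R^2\times\mathbb R\cong\mathbb R^3$, oriented by increasing $t$; it meets the plane $\mathbb R^2\times\{0\}$ at $y$. For a line $\ell$, $|\ell|$ denotes the distance from $\ell$ to the origin. Central projection: place $\mathbb R^3$ as the tangent hyperplane $\mathbb R^3\times\{1\}$ to $S^3\subset\mathbb R^4$ at the north pole $(0,0,0,1)$. Radial projection from the center of $S^3$ maps the open upper hemisphere bijectively to $\mathbb R^3$ and takes the open upper half of each great circle not contained in the equator $S^2=S^3\cap(\mathbb R^3\times\{0\})$ to a line. A $(1,3)$-fibration corresponds via central projection to a fibration of $S^3$ by oriented great circles if its lines are exactly the images, under this projection, of the great circles (not contained in the equator) of some continuous fibration of $S^3$ by pairwise disjoint oriented great circles. *)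

theory Defs
  imports "HOL-Analysis.Analysis"
begin

text \<open>An oriented affine line in \<open>\<real>\<^sup>3\<close> is encoded as the pair of its point set and its unit direction.\<close>

type_synonym oriented_line = "(real^3) set \<times> (real^3)"

definition oriented_lines :: "oriented_line set" where
  "oriented_lines = {(range (\<lambda>t. p + t *\<^sub>R u), u) | p u. norm u = 1}"

definition parallel_lines :: "oriented_line \<Rightarrow> oriented_line \<Rightarrow> bool" where
  "parallel_lines l m \<longleftrightarrow> snd l = snd m \<or> snd l = - snd m"

definition skew_lines :: "oriented_line \<Rightarrow> oriented_line \<Rightarrow> bool" where
  "skew_lines l m \<longleftrightarrow> fst l \<inter> fst m = {} \<and> \<not> parallel_lines l m"

definition fiber_direction :: "oriented_line set \<Rightarrow> real^3 \<Rightarrow> real^3" where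
  "fiber_direction M x = snd (THE l. l \<in> M \<and> x \<in> fst l)"

definition skew_line_fibration :: "oriented_line set \<Rightarrow> bool" where
  "skew_line_fibration M \<longleftrightarrow>
     M \<subseteq> oriented_lines \<and>
     (\<forall>x. \<exists>!l. l \<in> M \<and> x \<in> fst l) \<and>
     continuous_on UNIV (fiber_direction M) \<and>
     (\<forall>l\<in>M. \<forall>m\<in>M. l \<noteq> m \<longrightarrow> skew_lines l m)"

text \<open>A copy of \<open>\<real>\<^sup>2\<close> in \<open>\<real>\<^sup>3\<close>: the affine plane through \<open>a\<close> with orthonormal
  coordinate vectors \<open>e1\<close>, \<open>e2\<close> and unit normal \<open>n\<close>, recorded through the resulting
  map from \<open>\<real>\<^sup>2 \<times> \<real>\<close> to \<open>\<real>\<^sup>3\<close>. The basis may have either handedness.\<close>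

definition euclidean_identification :: "((real^2) \<times> real \<Rightarrow> real^3) \<Rightarrow> bool" where
  "euclidean_identification \<Phi> \<longleftrightarrow>
     (\<exists>a e1 e2 n. norm e1 = 1 \<and> norm e2 = 1 \<and> norm n = 1 \<and>
        e1 \<bullet> e2 = 0 \<and> e1 \<bullet> n = 0 \<and> e2 \<bullet> n = 0 \<and>
        \<Phi> = (\<lambda>(y, t). a + (y $ 1) *\<^sub>R e1 + (y $ 2) *\<^sub>R e2 + t *\<^sub>R n))"

text \<open>The graph of \<open>t \<mapsto> B(y) t + y\<close>, transported to \<open>\<real>\<^sup>3\<close>; the direction points from
  the graph point at \<open>t = 0\<close> to the one at \<open>t = 1\<close>.\<close>

definition graph_line ::
    "((real^2) \<times> real \<Rightarrow> real^3) \<Rightarrow> (real^2 \<Rightarrow> real^2) \<Rightarrow> real^2 \<Rightarrow> oriented_line" where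
  "graph_line \<Phi> B y =
     (range (\<lambda>t. \<Phi> (t *\<^sub>R B y + y, t)), sgn (\<Phi> (B y + y, 1) - \<Phi> (y, 0)))"

definition columns_matrix :: "(real^2 \<Rightarrow> real^2) \<Rightarrow> real^2 \<Rightarrow> real^2^2" where
  "columns_matrix B y = (\<chi> i j. if j = 1 then B y $ i else y $ i)"

definition trivial_kernels :: "(real^2 \<Rightarrow> real^2) \<Rightarrow> bool" where
  "trivial_kernels B \<longleftrightarrow>
     (\<forall>y z. y \<noteq> z \<longrightarrow> {v. (columns_matrix B y - columns_matrix B z) *v v = 0} = {0})"

text \<open>Accumulation points of a sequence, not of its range: infinitely many indices count,
  so a constant sequence has one.\<close>

definition seq_accumulation_point :: "(nat \<Rightarrow> 'a::topological_space) \<Rightarrow> 'a \<Rightarrow> bool" where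
  "seq_accumulation_point s p \<longleftrightarrow> (\<forall>U. open U \<and> p \<in> U \<longrightarrow> infinite {n. s n \<in> U})"

definition line_norm :: "oriented_line \<Rightarrow> real" where
  "line_norm l = infdist 0 (fst l)"

definition fibers_escape :: "((real^2) \<times> real \<Rightarrow> real^3) \<Rightarrow> (real^2 \<Rightarrow> real^2) \<Rightarrow> bool" where
  "fibers_escape \<Phi> B \<longleftrightarrow>
     (\<forall>y :: nat \<Rightarrow> real^2. (\<nexists>p. seq_accumulation_point y p) \<longrightarrow>
        filterlim (\<lambda>n. line_norm (graph_line \<Phi> B (y n))) at_top sequentially)"

definition graph_presentation ::
    "oriented_line set \<Rightarrow> ((real^2) \<times> real \<Rightarrow> real^3) \<Rightarrow> (real^2 \<Rightarrow> real^2) \<Rightarrow> bool" where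
  "graph_presentation M \<Phi> B \<longleftrightarrow>
     euclidean_identification \<Phi> \<and> continuous_on UNIV B \<and> B 0 = 0 \<and>
     M = range (graph_line \<Phi> B) \<and> trivial_kernels B \<and> fibers_escape \<Phi> B"

text \<open>\<open>\<real>\<^sup>4\<close> is \<open>\<real>\<^sup>3 \<times> \<real>\<close>. An oriented great circle is encoded by its lift to the unit
  tangent bundle, i.e. the set of pairs of a point of the circle and its unit velocity there.\<close>

type_synonym oriented_circle = "(((real^3) \<times> real) \<times> ((real^3) \<times> real)) set"

definition oriented_great_circles :: "oriented_circle set" where
  "oriented_great_circles =
     {range (\<lambda>t. (cos t *\<^sub>R p + sin t *\<^sub>R v, cos t *\<^sub>R v - sin t *\<^sub>R p)) | p v.
        norm p = 1 \<and> norm v = 1 \<and> p \<bullet> v = 0}"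

definition circle_points :: "oriented_circle \<Rightarrow> ((real^3) \<times> real) set" where
  "circle_points C = fst ` C"

definition circle_velocity :: "oriented_circle set \<Rightarrow> (real^3) \<times> real \<Rightarrow> (real^3) \<times> real" where
  "circle_velocity F p = (THE v. \<exists>C\<in>F. (p, v) \<in> C)"

definition great_circle_fibration :: "oriented_circle set \<Rightarrow> bool" where
  "great_circle_fibration F \<longleftrightarrow>
     F \<subseteq> oriented_great_circles \<and>
     (\<forall>p\<in>sphere 0 1. \<exists>C\<in>F. p \<in> circle_points C) \<and>
     (\<forall>C\<in>F. \<forall>D\<in>F. C \<noteq> D \<longrightarrow> circle_points C \<inter> circle_points D = {}) \<and>
     continuous_on (sphere 0 1) (circle_velocity F)"

definition equator :: "((real^3) \<times> real) set" where
  "equator = {p \<in> sphere 0 1. snd p = 0}"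

text \<open>Radial projection to the hyperplane \<open>\<real>\<^sup>3 \<times> {1}\<close>; meaningful only where \<open>snd p > 0\<close>.\<close>

definition central_projection :: "(real^3) \<times> real \<Rightarrow> real^3" where
  "central_projection p = fst p /\<^sub>R snd p"

text \<open>The line is oriented by the derivative of the projected circle motion.\<close>

definition central_image :: "oriented_circle \<Rightarrow> oriented_line \<Rightarrow> bool" where
  "central_image C l \<longleftrightarrow>
     fst l = central_projection ` {p \<in> circle_points C. snd p > 0} \<and>
     norm (snd l) = 1 \<and>
     (\<forall>(p, v)\<in>C. snd p > 0 \<longrightarrow>
        (\<exists>c>0. ((\<lambda>t. central_projection (cos t *\<^sub>R p + sin t *\<^sub>R v))
                 has_vector_derivative c *\<^sub>R snd l) (at 0)))"

definition corresponds_to_great_circle_fibration :: "oriented_line set \<Rightarrow> bool" where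
  "corresponds_to_great_circle_fibration M \<longleftrightarrow>
     (\<exists>F. great_circle_fibration F \<and>
        M = {l. \<exists>C\<in>F. \<not> circle_points C \<subseteq> equator \<and> central_image C l})"

end

theory Submission
  imports Defs
begin

text \<open>
  Why some plane is a section of a skew fibration with direction field \<open>V\<close>. By invariance of domain the
  directions form an open subset of the sphere. If some fiber is perpendicular to \<open>w\<close>, then openness
  forces \<open>V x \<bullet> w\<close> to have opposite signs on the two sides of that fiber in its plane \<open>x \<bullet> w = s\<close>; hence
  every plane parallel to it contains exactly one fiber, whose direction is a continuous and injective
  function of \<open>s\<close>. The intermediate value theorem on this one-parameter family shows that the cone over
  the set of directions is convex. An open convex cone that does not contain \<open>0\<close> meets its dual cone, and a
  direction in the intersection is the normal of a plane which every fiber crosses transversally and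
  one fiber crosses perpendicularly, so that \<open>B 0 = 0\<close> there.

  Conversely, property (2) makes the injective map \<open>(y, t) \<mapsto> (t B(y) + y, t)\<close> proper, hence a
  homeomorphism by invariance of domain.

  For surjective \<open>B\<close> also \<open>(y, s) \<mapsto> (B(y) + s y, s)\<close> is a homeomorphism. The two maps cover the complement
  of the great circle at infinity of the plane (the horizon), and adding the horizon, oriented by the
  constant sign of \<open>det(y, B(y))\<close>, gives a set of oriented circles with closed graph, that is, a continuous
  fibration. If \<open>B\<close> omits a direction, the great circle through the corresponding point of the equator
  lies in the equator; since the horizon also consists of equatorial fibers and two
  great circles of a 2-sphere meet, this is impossible.
\<close>

section \<open>Direction fields of skew fibrations\<close>

lemma orthonormal_expansion:
  fixes a b c x :: "real^3"
  assumes "norm a = 1" "norm b = 1" "norm c = 1" "a \<bullet> b = 0" "a \<bullet> c = 0" "b \<bullet> c = 0"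
  shows "x = (x \<bullet> a) *\<^sub>R a + (x \<bullet> b) *\<^sub>R b + (x \<bullet> c) *\<^sub>R c"
proof -
  have sq: "a \<bullet> a = 1" "b \<bullet> b = 1" "c \<bullet> c = 1"
    using assms by (simp_all add: norm_eq_1)
  have ne: "a \<noteq> b" "a \<noteq> c" "b \<noteq> c"
    using assms sq by auto
  have "independent {a, b, c}"
    using assms sq by (intro pairwise_orthogonal_independent)
      (auto simp: pairwise_def orthogonal_def inner_commute)
  then have span: "span {a, b, c} = UNIV"
    using ne card_ge_dim_independent[of "{a, b, c}" UNIV] by (auto simp: dim_UNIV)
  define z where "z = x - ((x \<bullet> a) *\<^sub>R a + (x \<bullet> b) *\<^sub>R b + (x \<bullet> c) *\<^sub>R c)"
  \<comment> \<open>The residual \<open>z\<close> is orthogonal to a spanning set, hence to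
    itself.\<close>
  have "orthogonal z v" if "v \<in> {a, b, c}" for v
    using that assms sq
    by (auto simp: z_def orthogonal_def inner_diff_left inner_add_left inner_diff_right inner_add_right inner_commute)
  then have "orthogonal z z"
    using orthogonal_to_span[of z "{a, b, c}" z] span by (auto simp: orthogonal_commute)
  then show ?thesis by (simp add: z_def orthogonal_def)
qed

lemma orthogonal_expansion:
  fixes u m w x :: "real^3"
  assumes "u \<noteq> 0" "m \<noteq> 0" "w \<noteq> 0" "u \<bullet> m = 0" "u \<bullet> w = 0" "m \<bullet> w = 0" "x \<bullet> w = 0"
  obtains c d where "x = c *\<^sub>R u + d *\<^sub>R m"
proof -
  have "x = (x \<bullet> sgn u) *\<^sub>R sgn u + (x \<bullet> sgn m) *\<^sub>R sgn m + (x \<bullet> sgn w) *\<^sub>R sgn w"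
    by (rule orthonormal_expansion) (use assms in \<open>simp_all add: norm_sgn, simp_all add: sgn_div_norm\<close>)
  then have "x = ((x \<bullet> sgn u) / norm u) *\<^sub>R u + ((x \<bullet> sgn m) / norm m) *\<^sub>R m"
    using assms(7) by (simp add: sgn_div_norm divide_inverse)
  then show thesis by (rule that)
qed

lemma orthogonal_complement_pair:
  fixes u w :: "real^3"
  assumes "norm u = 1" "norm w = 1" "u \<bullet> w = 0"
  obtains m where "norm m = 1" "u \<bullet> m = 0" "w \<bullet> m = 0"
proof
  have "(norm (cross3 u w))\<^sup>2 = 1"
    using assms norm_cross_dot[of u w] by simp
  then show "norm (cross3 u w) = 1"
    by (metis norm_ge_zero one_power2 power2_eq_iff_nonneg zero_le_one)
qed (simp_all add: dot_cross_self)

lemma orthonormal_completion: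
  fixes u :: "real^3"
  assumes "norm u = 1"
  obtains v w where "norm v = 1" "norm w = 1" "u \<bullet> v = 0" "u \<bullet> w = 0" "v \<bullet> w = 0"
proof -
  obtain v0 where v0: "v0 \<noteq> 0" "orthogonal u v0"
    using orthogonal_to_vector_exists[of u] by (auto simp: DIM_cart)
  define v where "v = sgn v0"
  have "norm v = 1" "u \<bullet> v = 0"
    using v0 by (auto simp: v_def norm_sgn orthogonal_def sgn_div_norm)
  then show thesis
    using orthogonal_complement_pair[OF assms] that by metis
qed

lemma unit_multiple_cases:
  fixes u v :: "'a::real_normed_vector"
  assumes "norm u = 1" "norm v = 1" "u = c *\<^sub>R v"
  shows "u = v \<or> u = - v"
proof -
  have "\<bar>c\<bar> = 1" using assms by simp
  then show ?thesis using assms(3) by (auto simp: abs_if split: if_splits)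
qed

lemma range_line_shift:
  fixes p u :: "'a::real_vector"
  shows "range (\<lambda>t. p + c *\<^sub>R u + t *\<^sub>R u) = range (\<lambda>t. p + t *\<^sub>R u)"
proof safe
  fix t
  show "p + c *\<^sub>R u + t *\<^sub>R u \<in> range (\<lambda>t. p + t *\<^sub>R u)"
    by (rule range_eqI[of _ _ "c + t"]) (simp add: algebra_simps)
  show "p + t *\<^sub>R u \<in> range (\<lambda>t. p + c *\<^sub>R u + t *\<^sub>R u)"
    by (rule range_eqI[of _ _ "t - c"]) (simp add: algebra_simps)
qed

lemma range_line_sgn:
  fixes v :: "'a::real_normed_vector"
  assumes "v \<noteq> 0"
  shows "range (\<lambda>t. p + t *\<^sub>R sgn v) = range (\<lambda>t. p + t *\<^sub>R v)"
proof safe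
  fix t
  show "p + t *\<^sub>R sgn v \<in> range (\<lambda>t. p + t *\<^sub>R v)"
    by (rule range_eqI[of _ _ "t / norm v"]) (simp add: sgn_div_norm divide_inverse)
  show "p + t *\<^sub>R v \<in> range (\<lambda>t. p + t *\<^sub>R sgn v)"
    by (rule range_eqI[of _ _ "t * norm v"]) (use assms in \<open>simp add: sgn_div_norm\<close>)
qed

lemma segment_zero:
  fixes f :: "'a::real_normed_vector \<Rightarrow> real"
  assumes f: "continuous_on UNIV f" and "f a < 0" "f b > 0"
  obtains s where "0 < s" "s < 1" "f (a + s *\<^sub>R (b - a)) = 0"
proof -
  have "\<exists>s\<ge>0. s \<le> 1 \<and> f (a + s *\<^sub>R (b - a)) = 0"
    using assms by (intro IVT' continuous_on_compose2[OF f] continuous_intros) auto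
  then obtain s where s: "0 \<le> s" "s \<le> 1" "f (a + s *\<^sub>R (b - a)) = 0" by blast
  moreover have "s \<noteq> 0" "s \<noteq> 1" using s assms(2,3) by (auto intro!: notI)
  ultimately show thesis using that[of s] by simp
qed

text \<open>A fibration is represented by its unit direction field. \<open>along\<close> makes
  \<open>V\<close> constant on fibers; \<open>parallel\<close> says that equal or opposite
  directions occur only along one fiber. Together they give pairwise skewness, because fibers
  through a common point share their direction.\<close>

locale skew_direction_field =
  fixes V :: "real^3 \<Rightarrow> real^3"
  assumes continuous: "continuous_on UNIV V"
    and unit [simp]: "norm (V x) = 1"
    and along [simp]: "V (x + t *\<^sub>R V x) = V x"
    and parallel: "V x = V y \<or> V x = - V y \<Longrightarrow> \<exists>t. y = x + t *\<^sub>R V x"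
begin

section \<open>Fibers crossing a plane and fibers contained in it\<close>

lemma continuous_inner: "continuous_on UNIV (\<lambda>x. V x \<bullet> w)"
  by (intro continuous_intros continuous)

lemma inner_self [simp]: "V x \<bullet> V x = 1"
  by (metis unit norm_eq_1)

lemma nonzero [simp]: "V x \<noteq> 0"
  using unit[of x] by force

lemma meet:
  assumes "x + s *\<^sub>R V x = y + t *\<^sub>R V y"
  shows "V x = V y"
  by (metis along assms)

lemma not_antipodal: "V x \<noteq> - V y"
proof
  assume *: "V x = - V y"
  then obtain t where "y = x + t *\<^sub>R V x" using parallel by blast
  then have "V y = V x" by simp
  moreover have "V x \<bullet> V y = - 1" using * by simp
  ultimately show False by simp
qed

lemma crossing:
  assumes "V x \<bullet> w \<noteq> 0"
  obtains t where "(x + t *\<^sub>R V x) \<bullet> w = s"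
  by (rule that[of "(s - x \<bullet> w) / (V x \<bullet> w)"]) (use assms in \<open>simp add: inner_add_left\<close>)

text \<open>Invariance of domain: the directions met near \<open>x\<close> fill a neighbourhood of
  \<open>V x\<close> on the sphere, so \<open>V x \<bullet> w = 0\<close> cannot be a minimum of the
  height along \<open>w\<close>.\<close>

lemma transverse_deviation:
  assumes "V x \<bullet> w = 0" "w \<noteq> 0"
  obtains x' where "V x' \<bullet> w < 0"
proof -
  define u where "u = V x"
  define e1 where "e1 = sgn w"
  have e1: "norm e1 = 1" "u \<bullet> e1 = 0"
    using assms by (simp_all add: e1_def u_def sgn_div_norm)
  have u: "norm u = 1" by (simp add: u_def)
  then have uu: "u \<bullet> u = 1" by (simp add: norm_eq_1)
  obtain e2 where e2: "norm e2 = 1" "u \<bullet> e2 = 0" "e1 \<bullet> e2 = 0"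
    using orthogonal_complement_pair[OF u e1] by blast
  \<comment> \<open>\<open>g\<close> parametrizes the plane through \<open>x\<close> perpendicular
    to \<open>u\<close>; \<open>f\<close> reads the direction at \<open>g y\<close> in the gnomonic
    chart of the sphere centred at \<open>u\<close>.\<close>
  define g :: "real^2 \<Rightarrow> real^3" where "g y = x + y $ 1 *\<^sub>R e1 + y $ 2 *\<^sub>R e2" for y
  define W where "W y = V (g y)" for y
  define f :: "real^2 \<Rightarrow> real^2" where "f y = (\<chi> i. (W y \<bullet> (if i = 1 then e1 else e2)) / (W y \<bullet> u))" for y
  have contW: "continuous_on UNIV W"
    unfolding W_def g_def
    by (intro continuous_on_compose2[OF continuous] continuous_intros) auto
  have W0: "W 0 = u" by (simp add: W_def g_def u_def)
  have "open ((\<lambda>y. W y \<bullet> u) -` {0<..})"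
    by (intro open_vimage continuous_intros contW)
  moreover have "0 \<in> (\<lambda>y. W y \<bullet> u) -` {0<..}" using W0 uu by simp
  ultimately obtain r where r: "r > 0" "ball 0 r \<subseteq> (\<lambda>y. W y \<bullet> u) -` {0<..}"
    using openE by metis
  have pos: "W y \<bullet> u > 0" if "y \<in> ball 0 r" for y using r that by auto
  have expand: "W y = (W y \<bullet> u) *\<^sub>R (u + (f y $ 1) *\<^sub>R e1 + (f y $ 2) *\<^sub>R e2)" if "y \<in> ball 0 r" for y
    using orthonormal_expansion[OF u e1(1) e2(1) e1(2) e2(2,3), of "W y"] pos[OF that]
    by (simp add: f_def scaleR_right_distrib)
  \<comment> \<open>Equal chart values give parallel directions, hence one fiber, and a fiber
    transverse to the plane of \<open>g\<close> meets it only once.\<close>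
  have "inj_on f (ball 0 r)"
  proof (rule inj_onI)
    fix y z assume yz: "y \<in> ball 0 r" "z \<in> ball 0 r" "f y = f z"
    define c where "c = (W y \<bullet> u) / (W z \<bullet> u)"
    have "c > 0" using pos yz by (simp add: c_def)
    have "W y = c *\<^sub>R W z"
      using expand[OF yz(1)] expand[OF yz(2)] yz(3) pos[OF yz(2)]
      by (metis c_def less_irrefl nonzero_eq_divide_eq scaleR_scaleR)
    then have "W y = W z \<or> W y = - W z"
      unfolding W_def by (rule unit_multiple_cases[OF unit unit])
    then obtain t where t: "g z = g y + t *\<^sub>R W y" using parallel by (auto simp: W_def)
    have "g z \<bullet> u = g y \<bullet> u" using e1 e2 by (simp add: g_def inner_add_left inner_add_right inner_commute)
    then have "t = 0" using t pos[OF yz(1)] by (simp add: inner_add_left)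
    then have *: "g z = g y" using t by simp
    have sq: "e1 \<bullet> e1 = 1" "e2 \<bullet> e2 = 1" using e1 e2 by (simp_all add: norm_eq_1)
    have "g z \<bullet> e1 = g y \<bullet> e1" "g z \<bullet> e2 = g y \<bullet> e2" using * by simp_all
    then have "z $ 1 = y $ 1" "z $ 2 = y $ 2"
      using e2(3) sq by (simp_all add: g_def inner_add_left inner_commute[of e2 e1])
    then show "y = z" by (simp add: vec_eq_iff forall_2)
  qed
  moreover have "continuous_on (ball 0 r) f"
    unfolding f_def
    by (intro continuous_on_vec_lambda continuous_intros continuous_on_subset[OF contW]) (use pos in force)+
  ultimately have "open (f ` ball 0 r)" by (intro invariance_of_domain) auto
  moreover have "0 \<in> f ` ball 0 r"
  proof
    show "0 = f 0" unfolding f_def W0 using e1 e2 by (simp add: vec_eq_iff)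
  qed (use r in simp)
  ultimately obtain d where d: "d > 0" "ball 0 d \<subseteq> f ` ball 0 r" using openE by metis
  \<comment> \<open>A chart value with negative first coordinate is a direction below the plane
    perpendicular to \<open>w\<close>, as \<open>W y \<bullet> u\<close> is positive.\<close>
  have "axis 1 (- d / 2) \<in> ball (0::real^2) d" using d by (simp add: norm_eq_sqrt_inner inner_axis_axis real_sqrt_divide)
  then obtain y where y: "y \<in> ball 0 r" "axis 1 (- d / 2) = f y" using d by blast
  have "f y $ 1 < 0" using d by (simp add: y(2)[symmetric] axis_def)
  then have "W y \<bullet> e1 < 0" using pos[OF y(1)] by (simp add: f_def divide_less_0_iff)
  then have "V (g y) \<bullet> w < 0" by (simp add: W_def e1_def sgn_div_norm mult_less_0_iff)
  then show thesis by (rule that)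
qed

lemma transverse_deviation':
  assumes "V x \<bullet> w = 0" "w \<noteq> 0"
  obtains x' where "V x' \<bullet> w > 0"
  using transverse_deviation[of x "- w"] assms by auto

text \<open>Another fiber lying in the plane of \<open>V x\<close> and \<open>m\<close> would either
  meet the fiber of \<open>x\<close> (\<open>d \<noteq> 0\<close>) or be parallel to it
  (\<open>d = 0\<close>).\<close>

lemma transverse_off_fiber:
  assumes "V x \<bullet> w = 0" "w \<noteq> 0" "m \<noteq> 0" "m \<bullet> w = 0" "V x \<bullet> m = 0" "b \<noteq> 0"
  shows "V (x + a *\<^sub>R V x + b *\<^sub>R m) \<bullet> w \<noteq> 0"
proof
  define z where "z = x + a *\<^sub>R V x + b *\<^sub>R m"
  assume "V (x + a *\<^sub>R V x + b *\<^sub>R m) \<bullet> w = 0"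
  then obtain c d where cd: "V z = c *\<^sub>R V x + d *\<^sub>R m"
    using orthogonal_expansion[of "V x" m w "V z"] assms by (auto simp: z_def)
  have "d = 0"
  proof (rule ccontr)
    assume "d \<noteq> 0"
    \<comment> \<open>At parameter \<open>- b / d\<close> the components along \<open>m\<close>
      cancel, so the line through \<open>z\<close> reaches the fiber of \<open>x\<close>.\<close>
    then have "z + (- b / d) *\<^sub>R (c *\<^sub>R V x + d *\<^sub>R m) = x + (a - b * c / d) *\<^sub>R V x"
      by (simp add: z_def algebra_simps)
    then have "z + (- b / d) *\<^sub>R V z = x + (a - b * c / d) *\<^sub>R V x" by (simp only: cd)
    then have "V z = V x" by (rule meet)
    then have "(c *\<^sub>R V x + d *\<^sub>R m) \<bullet> m = 0" using cd assms(5) by metis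
    then show False using \<open>d \<noteq> 0\<close> assms(3,5) by (simp add: inner_add_left)
  qed
  then have "V x = V z \<or> V x = - V z"
    using unit_multiple_cases[of "V z" "V x" c] cd by (metis add.right_neutral minus_minus scale_zero_left unit)
  then obtain t where "z = x + t *\<^sub>R V x" using parallel by blast
  then have "(t - a) *\<^sub>R V x = b *\<^sub>R m" by (simp add: z_def algebra_simps)
  then have "((t - a) *\<^sub>R V x) \<bullet> m = (b *\<^sub>R m) \<bullet> m" by simp
  then show False using assms by simp
qed

lemma in_plane_coordinates:
  assumes "V x \<bullet> w = 0" "w \<noteq> 0" "m \<noteq> 0" "m \<bullet> w = 0" "V x \<bullet> m = 0" "z \<bullet> w = x \<bullet> w"
  obtains a b where "z = x + a *\<^sub>R V x + b *\<^sub>R m"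
proof -
  have "(z - x) \<bullet> w = 0" using assms by (simp add: inner_diff_left)
  then obtain a b where "z - x = a *\<^sub>R V x + b *\<^sub>R m"
    using orthogonal_expansion[of "V x" m w "z - x"] assms by auto
  then show thesis using that[of a b] by (simp add: algebra_simps)
qed

lemma unique_in_plane:
  assumes "V x \<bullet> w = 0" "V y \<bullet> w = 0" "w \<noteq> 0" "x \<bullet> w = y \<bullet> w"
  shows "V x = V y"
proof -
  define m where "m = cross3 (V x) w"
  have m: "m \<bullet> w = 0" "V x \<bullet> m = 0" by (simp_all add: m_def dot_cross_self)
  have "(norm m)\<^sup>2 = (norm w)\<^sup>2" using norm_cross_dot[of "V x" w] assms(1) by (simp add: m_def)
  then have m0: "m \<noteq> 0" using assms by auto
  obtain a b where ab: "y = x + a *\<^sub>R V x + b *\<^sub>R m"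
    using in_plane_coordinates[of x w m y] assms m m0 by auto
  then have "b = 0" using transverse_off_fiber[of x w m b a] assms m m0 by auto
  then show ?thesis using ab by simp
qed

text \<open>An open half-plane bounded by the fiber is convex and \<open>V\<close> is nowhere
  perpendicular to \<open>w\<close> on it, so the intermediate value theorem forbids a change of
  sign.\<close>

lemma same_sign_on_side:
  assumes "V x \<bullet> w = 0" "w \<noteq> 0" "m \<noteq> 0" "m \<bullet> w = 0" "V x \<bullet> m = 0" "b > 0"
    and "V (x + a *\<^sub>R V x + b *\<^sub>R m) \<bullet> w < 0"
  shows "V (x + m) \<bullet> w < 0"
proof (rule ccontr)
  define z where "z = x + a *\<^sub>R V x + b *\<^sub>R m"
  assume "\<not> V (x + m) \<bullet> w < 0"
  then have "V (x + m) \<bullet> w > 0"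
    using transverse_off_fiber[of x w m 1 0] assms by auto
  then obtain s where s: "0 < s" "s < 1" "V (z + s *\<^sub>R (x + m - z)) \<bullet> w = 0"
    using segment_zero[OF continuous_inner, of z w "x + m"] assms(7) by (auto simp: z_def)
  have "z + s *\<^sub>R (x + m - z) = x + (a - s * a) *\<^sub>R V x + (b - s * b + s) *\<^sub>R m"
    by (simp add: z_def algebra_simps)
  moreover have "b - s * b + s \<noteq> 0"
  proof -
    have "s * b < b" using s assms by simp
    then show ?thesis using s by simp
  qed
  ultimately show False
    using transverse_off_fiber[of x w m "b - s * b + s" "a - s * a"] assms s(3) by auto
qed

text \<open>Some fiber has negative component along \<open>w\<close>. Being transverse, it crosses
  the plane, necessarily off the fiber of \<open>x\<close>, and fixes the sign on the side where it
  crosses.\<close>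

lemma not_both_positive:
  assumes "V x \<bullet> w = 0" "w \<noteq> 0" "m \<noteq> 0" "m \<bullet> w = 0" "V x \<bullet> m = 0"
  shows "V (x + m) \<bullet> w < 0 \<or> V (x - m) \<bullet> w < 0"
proof -
  obtain x' where x': "V x' \<bullet> w < 0" using transverse_deviation assms by blast
  then obtain t where t: "(x' + t *\<^sub>R V x') \<bullet> w = x \<bullet> w" using crossing[of x' w "x \<bullet> w"] by auto
  define z where "z = x' + t *\<^sub>R V x'"
  have Vz: "V z \<bullet> w < 0" using x' by (simp add: z_def)
  obtain a b where ab: "z = x + a *\<^sub>R V x + b *\<^sub>R m"
    using in_plane_coordinates[of x w m z] assms t by (auto simp: z_def)
  then have "b \<noteq> 0" using Vz assms(1) by auto
  then consider "b > 0" | "- b > 0" by linarith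
  then show ?thesis
  proof cases
    case 1
    then show ?thesis using same_sign_on_side[of x w m b a] assms Vz ab by auto
  next
    case 2
    then show ?thesis using same_sign_on_side[of x w "- m" "- b" a] assms Vz ab by auto
  qed
qed

lemma sign_change:
  assumes "V x \<bullet> w = 0" "w \<noteq> 0" "m \<noteq> 0" "m \<bullet> w = 0" "V x \<bullet> m = 0"
  shows "(V (x + m) \<bullet> w) * (V (x - m) \<bullet> w) < 0"
  using not_both_positive[of x w m] not_both_positive[of x "- w" m] assms
  by (auto simp: mult_less_0_iff)

lemma perpendicular_to_fiber:
  assumes "V x \<bullet> w = 0" "w \<noteq> 0"
  obtains m where "norm m = 1" "m \<bullet> w = 0" "V x \<bullet> m = 0"
proof -
  have "norm (sgn w) = 1" "V x \<bullet> sgn w = 0" using assms by (simp_all add: sgn_div_norm)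
  then obtain m where "norm m = 1" "V x \<bullet> m = 0" "sgn w \<bullet> m = 0"
    using orthogonal_complement_pair[OF unit, of "sgn w" x] by blast
  then show thesis using that[of m] assms by (simp add: sgn_div_norm inner_commute)
qed

text \<open>Fibers with components of either sign along \<open>w\<close> cross every plane
  perpendicular to \<open>w\<close>; between two such crossing points \<open>V z \<bullet> w\<close>
  has a zero.\<close>

lemma exists_in_plane:
  assumes "V x \<bullet> w = 0" "w \<noteq> 0"
  obtains y where "y \<bullet> w = s" "V y \<bullet> w = 0"
proof -
  obtain p q where p: "V p \<bullet> w < 0" and q: "V q \<bullet> w > 0"
    using transverse_deviation transverse_deviation' assms by metis
  obtain t where t: "(p + t *\<^sub>R V p) \<bullet> w = s" using crossing[of p w s] p by auto
  obtain t' where t': "(q + t' *\<^sub>R V q) \<bullet> w = s" using crossing[of q w s] q by auto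
  define p' q' where "p' = p + t *\<^sub>R V p" and "q' = q + t' *\<^sub>R V q"
  have "p' \<bullet> w = s" "q' \<bullet> w = s" using t t' by (simp_all add: p'_def q'_def)
  obtain r where r: "V (p' + r *\<^sub>R (q' - p')) \<bullet> w = 0"
    using segment_zero[OF continuous_inner, of p' w q'] p q by (auto simp: p'_def q'_def)
  show thesis
    by (rule that[OF _ r]) (simp add: \<open>p' \<bullet> w = s\<close> \<open>q' \<bullet> w = s\<close> inner_add_left inner_diff_left)
qed

section \<open>The fibers parallel to a given plane, and convexity of the cone of directions\<close>

definition plane_direction :: "real^3 \<Rightarrow> real \<Rightarrow> real^3" where
  "plane_direction w s = V (SOME x. x \<bullet> w = s \<and> V x \<bullet> w = 0)"

lemma plane_direction_eq:
  assumes "V x \<bullet> w = 0" "w \<noteq> 0"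
  shows "plane_direction w (x \<bullet> w) = V x"
proof -
  have "(SOME y. y \<bullet> w = x \<bullet> w \<and> V y \<bullet> w = 0) \<bullet> w = x \<bullet> w \<and> V (SOME y. y \<bullet> w = x \<bullet> w \<and> V y \<bullet> w = 0) \<bullet> w = 0"
    by (rule someI[of _ x]) (simp add: assms)
  then show ?thesis unfolding plane_direction_def
    using unique_in_plane assms by blast
qed

text \<open>By \<open>unique_in_plane\<close> the choice in \<open>plane_direction\<close> does not
  affect the direction. The opposite signs at \<open>x + m'\<close> and \<open>x - m'\<close>
  persist when the plane is shifted slightly, so the fiber in the nearby plane passes between the
  shifted points and its direction is close to \<open>V x\<close>.\<close>

lemma continuous_plane_direction:
  assumes x0: "V x0 \<bullet> w = 0" and w: "w \<noteq> 0"
  shows "continuous_on UNIV (plane_direction w)"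
proof -
  have "isCont (plane_direction w) s" for s
  proof -
    obtain x where x: "x \<bullet> w = s" "V x \<bullet> w = 0" using exists_in_plane assms by metis
    obtain m where m: "norm m = 1" "m \<bullet> w = 0" "V x \<bullet> m = 0"
      using perpendicular_to_fiber x(2) w by blast
    show ?thesis
      unfolding isCont_def tendsto_iff
    proof (intro allI impI)
      fix e :: real assume "e > 0"
      have "isCont V x" using continuous continuous_on_eq_continuous_at by blast
      then obtain d where d: "d > 0" "\<And>y. dist y x < d \<Longrightarrow> dist (V y) (V x) < e"
        using \<open>e > 0\<close> unfolding continuous_at_eps_delta by blast
      \<comment> \<open>Half of \<open>d\<close>: a shift along \<open>w\<close> shorter than
        \<open>d / 2\<close> and a step of at most \<open>d / 2\<close> along \<open>m'\<close> stay
        within distance \<open>d\<close> of \<open>x\<close>.\<close>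
      define m' where "m' = (d / 2) *\<^sub>R m"
      have m': "m' \<noteq> 0" "m' \<bullet> w = 0" "V x \<bullet> m' = 0" "norm m' = d / 2"
        using m d by (auto simp: m'_def)
      define f where "f r = (V (x + m' + r *\<^sub>R w) \<bullet> w) * (V (x - m' + r *\<^sub>R w) \<bullet> w)" for r
      have "isCont f 0"
        unfolding f_def
        by (intro continuous_intros isCont_o2[OF _ continuous_on_interior[OF continuous_inner]]) auto
      moreover have "f 0 < 0" using sign_change[of x w m'] x w m' by (simp add: f_def)
      ultimately have ev: "eventually (\<lambda>r. f r < 0) (nhds 0)"
        by (simp add: isCont_def tendsto_at_iff_tendsto_nhds order_tendstoD)
      \<comment> \<open>Shifting by \<open>g s' *\<^sub>R w\<close> carries the plane at level
        \<open>s\<close> to the plane at level \<open>s'\<close>.\<close>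
      define g where "g s' = (s' - s) / (w \<bullet> w)" for s'
      have "(g \<longlongrightarrow> g s) (at s)" unfolding g_def by (intro tendsto_intros) (use w in auto)
      then have g0: "filterlim g (nhds 0) (at s)" by (simp add: g_def)
      have "((\<lambda>s'. norm (g s' *\<^sub>R w)) \<longlongrightarrow> norm ((0::real) *\<^sub>R w)) (at s)"
        by (intro tendsto_intros g0)
      then have "eventually (\<lambda>s'. norm (g s' *\<^sub>R w) < d / 2) (at s)"
        using d by (intro order_tendstoD) auto
      moreover have "eventually (\<lambda>s'. f (g s') < 0) (at s)"
        using ev g0 by (rule eventually_compose_filterlim)
      ultimately show "eventually (\<lambda>s'. dist (plane_direction w s') (plane_direction w s) < e) (at s)"
      proof eventually_elim
        case (elim s')
        define c where "c = x + g s' *\<^sub>R w"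
        have "(V (c - m') \<bullet> w) * (V (c + m') \<bullet> w) < 0"
          using elim(2) by (simp add: f_def c_def algebra_simps)
        then have "(V (c - m') \<bullet> w < 0 \<and> V (c - (- m')) \<bullet> w > 0) \<or> (V (c - (- m')) \<bullet> w < 0 \<and> V (c - m') \<bullet> w > 0)"
          by (auto simp: mult_less_0_iff)
        then obtain n where n: "n = m' \<or> n = - m'" "V (c - n) \<bullet> w < 0" "V (c + n) \<bullet> w > 0"
          by (metis add_uminus_conv_diff diff_minus_eq_add)
        obtain r where r: "0 < r" "r < 1" "V (c - n + r *\<^sub>R (c + n - (c - n))) \<bullet> w = 0"
          using segment_zero[OF continuous_inner n(2,3)] by blast
        define y where "y = c + (2 * r - 1) *\<^sub>R n"
        have "c - n + r *\<^sub>R (c + n - (c - n)) = y" by (simp add: y_def vec_eq_iff algebra_simps)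
        then have y: "V y \<bullet> w = 0" using r(3) by simp
        have "n \<bullet> w = 0" "norm n = d / 2" using n m' by auto
        then have "y \<bullet> w = s'"
          using w x by (simp add: y_def c_def g_def inner_add_left)
        then have "plane_direction w s' = V y" using plane_direction_eq[OF y w] by simp
        moreover have "plane_direction w s = V x" using plane_direction_eq[OF x(2) w] x by simp
        moreover have "dist y x < d"
        proof -
          have "dist y x = norm (g s' *\<^sub>R w + (2 * r - 1) *\<^sub>R n)"
            by (simp add: dist_norm y_def c_def algebra_simps)
          also have "\<dots> \<le> norm (g s' *\<^sub>R w) + \<bar>2 * r - 1\<bar> * norm n"
            by (metis norm_triangle_ineq norm_scaleR)
          also have "\<dots> < d / 2 + 1 * (d / 2)"
            using elim(1) r \<open>norm n = d / 2\<close> d by (intro add_less_le_mono mult_right_mono) auto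
          finally show ?thesis by simp
        qed
        ultimately show ?case using d(2)[of y] by simp
      qed
    qed
  qed
  then show ?thesis by (simp add: continuous_at_imp_continuous_on)
qed

text \<open>Both fibers are perpendicular to \<open>w = cross3 u1 u2\<close>. The planes between
  theirs each contain one fiber, and its direction moves continuously from \<open>u1\<close> to
  \<open>u2\<close> within their span, so it passes through the ray of the given
  combination.\<close>

lemma positive_combination:
  assumes "a > 0" "b > 0"
  obtains c x where "c > 0" "a *\<^sub>R V x1 + b *\<^sub>R V x2 = c *\<^sub>R V x"
proof (cases "V x1 = V x2")
  case True
  then show thesis using that[of "a + b" x1] assms by (simp add: scaleR_add_left)
next
  case False
  define u1 u2 w where "u1 = V x1" and "u2 = V x2" and "w = cross3 u1 u2"
  have orth: "u1 \<bullet> w = 0" "u2 \<bullet> w = 0" by (simp_all add: w_def dot_cross_self)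
  have w: "w \<noteq> 0"
  proof
    assume "w = 0"
    then have "collinear {0, u1, u2}" by (simp add: w_def cross_eq_0)
    then obtain c where "u2 = c *\<^sub>R u1"
      using nonzero[of x1] nonzero[of x2] unfolding collinear_lemma u1_def u2_def by blast
    then have "u2 = u1 \<or> u2 = - u1"
      unfolding u1_def u2_def by (rule unit_multiple_cases[OF unit unit])
    then show False using False not_antipodal[of x2 x1] by (auto simp: u1_def u2_def)
  qed
  define s where "s r = x1 \<bullet> w + r * (x2 \<bullet> w - x1 \<bullet> w)" for r
  define D where "D r = plane_direction w (s r)" for r
  have s_ne: "x1 \<bullet> w \<noteq> x2 \<bullet> w"
    using unique_in_plane[of x1 w x2] orth w False by (auto simp: u1_def u2_def)
  have D0: "D 0 = u1" and D1: "D 1 = u2"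
    using plane_direction_eq[of x1 w] plane_direction_eq[of x2 w] orth w
    by (simp_all add: D_def s_def u1_def u2_def)
  have contD: "continuous_on UNIV D"
    unfolding D_def s_def
    by (intro continuous_on_compose2[OF continuous_plane_direction[of x1 w]] continuous_intros)
      (use orth w in \<open>auto simp: u1_def\<close>)
  have fiber: "\<exists>x. x \<bullet> w = s r \<and> V x \<bullet> w = 0 \<and> D r = V x" for r
  proof -
    obtain x where "x \<bullet> w = s r" "V x \<bullet> w = 0"
      using exists_in_plane[of x1 w] orth w by (auto simp: u1_def)
    then show ?thesis using plane_direction_eq[of x w] w by (auto simp: D_def)
  qed
  \<comment> \<open>Coordinates of \<open>D r\<close> in the basis \<open>u1\<close>,
    \<open>u2\<close> by Cramer's rule, scaled by \<open>w \<bullet> w\<close>.\<close>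
  define mu lam where "mu r = cross3 u1 (D r) \<bullet> w" and "lam r = cross3 (D r) u2 \<bullet> w" for r
  have expand: "(w \<bullet> w) *\<^sub>R D r = lam r *\<^sub>R u1 + mu r *\<^sub>R u2" for r
  proof -
    have "D r \<bullet> w = 0" using fiber by metis
    moreover have "(w \<bullet> w) *\<^sub>R D r = lam r *\<^sub>R u1 + mu r *\<^sub>R u2 + (D r \<bullet> w) *\<^sub>R w"
      unfolding lam_def mu_def w_def by (simp add: cross3_simps forall_3)
    ultimately show ?thesis by simp
  qed
  have cont: "continuous_on UNIV mu" "continuous_on UNIV lam"
    unfolding mu_def lam_def by (intro continuous_intros continuous_on_cross contD)+
  have ww: "w \<bullet> w > 0" using w by simp
  have mu1: "mu 1 > 0" "lam 1 = 0" "mu 0 = 0" "lam 0 > 0"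
    using ww by (simp_all add: mu_def lam_def D0 D1 w_def)
  \<comment> \<open>If \<open>mu r = 0\<close>, the fiber at \<open>r\<close> is parallel to the
    fiber of \<open>x1\<close> and hence equal to it, which forces \<open>r = 0\<close> since the
    two planes have different levels.\<close>
  have mu_ne: "mu r \<noteq> 0" if "r \<noteq> 0" for r
  proof
    assume "mu r = 0"
    then have "(w \<bullet> w) *\<^sub>R D r = lam r *\<^sub>R u1" using expand[of r] by simp
    then have "D r = (lam r / (w \<bullet> w)) *\<^sub>R u1" using ww
      by (metis divideR_right divide_inverse_commute less_irrefl scaleR_scaleR)
    moreover obtain x where x: "x \<bullet> w = s r" "D r = V x" using fiber by blast
    ultimately have "V x = (lam r / (w \<bullet> w)) *\<^sub>R V x1" by (simp add: u1_def)
    then have "V x = V x1 \<or> V x = - V x1" by (rule unit_multiple_cases[OF unit unit])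
    then have "V x1 = V x \<or> V x1 = - V x" by auto
    then obtain t where "x = x1 + t *\<^sub>R V x1" using parallel by blast
    then have "s r = x1 \<bullet> w" using x orth by (simp add: u1_def inner_add_left)
    then show False using s_ne that by (simp add: s_def)
  qed
  \<comment> \<open>A zero of \<open>e\<close> is a parameter where \<open>D r\<close> is
    proportional to \<open>a *\<^sub>R u1 + b *\<^sub>R u2\<close>.\<close>
  define e where "e r = a * mu r - b * lam r" for r
  have "\<exists>r\<ge>0. r \<le> 1 \<and> e r = 0"
  proof (rule IVT')
    show "continuous_on {0..1} e"
      unfolding e_def
      by (intro continuous_intros continuous_on_subset[OF cont(1)] continuous_on_subset[OF cont(2)]) simp_all
  qed (use mu1 assms in \<open>simp_all add: e_def\<close>)
  then obtain r where r: "0 \<le> r" "r \<le> 1" "a * mu r = b * lam r" by (auto simp: e_def)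
  have "r \<noteq> 0"
  proof
    assume "r = 0"
    then have "b * lam 0 = 0" using r(3) mu1(3) by simp
    then show False using mu1(4) assms by simp
  qed
  \<comment> \<open>This excludes a negative factor of proportionality: \<open>mu\<close> is
    positive at 1 and has no zero on the way there.\<close>
  have mu_pos: "mu r > 0"
  proof (rule ccontr)
    assume "\<not> mu r > 0"
    then have "\<exists>r'\<ge>r. r' \<le> 1 \<and> mu r' = 0"
      using mu1(1) r(2) by (intro IVT' continuous_on_subset[OF cont(1)]) simp_all
    then obtain r' where "r' \<ge> r" "mu r' = 0" by blast
    then show False using mu_ne[of r'] r(1) \<open>r \<noteq> 0\<close> by simp
  qed
  obtain x where x: "D r = V x" using fiber by blast
  show thesis
  proof (rule that)
    show "b * (w \<bullet> w) / mu r > 0" using mu_pos assms ww by simp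
    have "(b * (w \<bullet> w) / mu r) *\<^sub>R V x = (b / mu r) *\<^sub>R (lam r *\<^sub>R u1 + mu r *\<^sub>R u2)"
      using expand[of r] by (metis x scaleR_scaleR times_divide_eq_left)
    also have "\<dots> = a *\<^sub>R u1 + b *\<^sub>R u2"
      using mu_pos r(3) by (simp add: scaleR_add_right field_simps)
    finally show "a *\<^sub>R V x1 + b *\<^sub>R V x2 = (b * (w \<bullet> w) / mu r) *\<^sub>R V x"
      by (simp add: u1_def u2_def)
  qed
qed

text \<open>If the cone \<open>K\<close> of directions missed its dual \<open>K'\<close>, a
  separating normal \<open>m\<close> would be nonpositive on \<open>K\<close>, so all nonnegative
  multiples of \<open>- m\<close> would lie in \<open>K'\<close>, where \<open>m\<close> is bounded
  below. A direction in \<open>K \<inter> K'\<close> has nonnegative product with all directions,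
  and \<open>transverse_deviation\<close> makes it positive.\<close>

lemma central_direction:
  obtains x0 where "\<And>x. V x \<bullet> V x0 > 0"
proof -
  define K where "K = {c *\<^sub>R V x | c x. c > 0}"
  define K' where "K' = {n. \<forall>x. V x \<bullet> n \<ge> 0}"
  have "convex K"
  proof (rule convexI)
    fix p q and s t :: real assume *: "p \<in> K" "q \<in> K" "0 \<le> s" "0 \<le> t" "s + t = 1"
    show "s *\<^sub>R p + t *\<^sub>R q \<in> K"
    proof (cases "s = 0 \<or> t = 0")
      case True
      then show ?thesis using * by auto
    next
      case False
      obtain c x d y where "c > 0" "p = c *\<^sub>R V x" "d > 0" "q = d *\<^sub>R V y"
        using * by (auto simp: K_def)
      moreover from this obtain e z where "e > 0" "(s * c) *\<^sub>R V x + (t * d) *\<^sub>R V y = e *\<^sub>R V z"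
        using positive_combination[of "s * c" "t * d" x y] False * by auto
      ultimately show ?thesis by (auto simp: K_def)
    qed
  qed
  moreover have "convex K'"
    by (rule convexI) (auto simp: K'_def inner_add_right)
  moreover have V_in: "V x \<in> K" for x
    unfolding K_def mem_Collect_eq by (rule exI[of _ 1], rule exI[of _ x]) simp
  moreover have "0 \<in> K'" by (simp add: K'_def)
  moreover have "K \<inter> K' \<noteq> {}"
  proof
    assume "K \<inter> K' = {}"
    then obtain m b where m: "m \<noteq> 0" "\<forall>x\<in>K. m \<bullet> x \<le> b" "\<forall>x\<in>K'. m \<bullet> x \<ge> b"
      using separating_hyperplane_sets[of K K'] calculation by blast
    have b0: "b \<le> 0" using m(3) \<open>0 \<in> K'\<close> by force
    have "c *\<^sub>R (- m) \<in> K'" if "c \<ge> 0" for c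
    proof -
      have "m \<bullet> V x \<le> 0" for x
        using m(2) b0 V_in[of x] by force
      then show ?thesis using that by (auto simp: K'_def inner_commute mult_nonneg_nonpos)
    qed
    then have *: "b \<le> - c * (m \<bullet> m)" if "c \<ge> 0" for c
      using m(3) that by force
    show False using *[of "(1 - b) / (m \<bullet> m)"] m(1) b0 by simp
  qed
  ultimately obtain c x0 where x0: "c > 0" "c *\<^sub>R V x0 \<in> K'" by (auto simp: K_def)
  have nonneg: "V x \<bullet> V x0 \<ge> 0" for x
    using x0 by (auto simp: K'_def zero_le_mult_iff)
  have "V x \<bullet> V x0 \<noteq> 0" for x
    using transverse_deviation[of x "V x0"] nonneg by (metis nonzero not_less)
  then show thesis using that[of x0] nonneg by (simp add: order_less_le)
qed

end

section \<open>Reformulations of the two properties, and proper maps\<close>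

lemma trivial_kernels_iff:
  "trivial_kernels B \<longleftrightarrow>
    (\<forall>y z c d. y \<noteq> z \<longrightarrow> c *\<^sub>R (B y - B z) + d *\<^sub>R (y - z) = 0 \<longrightarrow> c = 0 \<and> d = 0)"
proof -
  have mult: "(columns_matrix B y - columns_matrix B z) *v v = v $ 1 *\<^sub>R (B y - B z) + v $ 2 *\<^sub>R (y - z)" for y z v
    by (simp add: matrix_vector_mult_def columns_matrix_def vec_eq_iff sum_2 mult.commute)
  have "{v. (columns_matrix B y - columns_matrix B z) *v v = 0} = {0} \<longleftrightarrow>
      (\<forall>c d. c *\<^sub>R (B y - B z) + d *\<^sub>R (y - z) = 0 \<longrightarrow> c = 0 \<and> d = 0)" (is "?l \<longleftrightarrow> ?r") for y z
  proof
    assume ?l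
    show ?r
    proof (intro allI impI)
      fix c d assume "c *\<^sub>R (B y - B z) + d *\<^sub>R (y - z) = 0"
      then have "vector [c, d] \<in> {v. (columns_matrix B y - columns_matrix B z) *v v = 0}"
        unfolding mem_Collect_eq mult by simp
      then have "vector [c, d] = (0 :: real^2)" using \<open>?l\<close> by simp
      then show "c = 0 \<and> d = 0" by (metis vector_2 zero_index)
    qed
  next
    assume ?r
    have zero: "v = 0" if "v $ 1 *\<^sub>R (B y - B z) + v $ 2 *\<^sub>R (y - z) = 0" for v :: "real^2"
      using \<open>?r\<close>[rule_format, OF that] by (simp add: vec_eq_iff forall_2)
    have "v \<in> {v. v $ 1 *\<^sub>R (B y - B z) + v $ 2 *\<^sub>R (y - z) = 0} \<longleftrightarrow> v \<in> {0}" for v :: "real^2"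
      unfolding mem_Collect_eq singleton_iff by (rule iffI, erule zero) simp
    then show ?l unfolding mult by (rule set_eqI)
  qed
  then show ?thesis unfolding trivial_kernels_def by metis
qed

text \<open>By Bolzano-Weierstrass a sequence that is infinitely often in a bounded set accumulates,
  while a sequence with \<open>norm (s n) > real n\<close> does not.\<close>

lemma escaping_iff_bounded_sublevels:
  fixes L :: "'a::{heine_borel, real_normed_vector} \<Rightarrow> real"
  shows "(\<forall>s. (\<nexists>p. seq_accumulation_point s p) \<longrightarrow> filterlim (\<lambda>n. L (s n)) at_top sequentially) \<longleftrightarrow>
    (\<forall>R. bounded {y. L y \<le> R})"
proof safe
  fix R
  assume esc: "\<forall>s. (\<nexists>p. seq_accumulation_point s p) \<longrightarrow> filterlim (\<lambda>n. L (s n)) at_top sequentially"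
  show "bounded {y. L y \<le> R}"
  proof (rule ccontr)
    assume "\<not> bounded {y. L y \<le> R}"
    then have "\<forall>n. \<exists>y. L y \<le> R \<and> norm y > real n" by (auto simp: bounded_iff not_le)
    then obtain s where s: "\<And>n. L (s n) \<le> R" "\<And>n. norm (s n) > real n" by metis
    have "\<not> seq_accumulation_point s p" for p
    proof
      assume "seq_accumulation_point s p"
      then have "infinite {n. s n \<in> ball p 1}"
        unfolding seq_accumulation_point_def by (metis centre_in_ball open_ball zero_less_one)
      moreover have "{n. s n \<in> ball p 1} \<subseteq> {n. real n < norm p + 1}"
      proof safe
        fix n assume "s n \<in> ball p 1"
        then have "norm (s n) \<le> norm p + 1"
          using norm_triangle_sub[of "s n" p] by (simp add: dist_norm norm_minus_commute)
        then show "real n < norm p + 1" using s(2)[of n] by simp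
      qed
      moreover have "{n. real n < norm p + 1} \<subseteq> {..nat \<lceil>norm p + 1\<rceil>}"
        by (auto simp: le_nat_iff) linarith
      ultimately show False by (meson finite_atMost finite_subset)
    qed
    then have "eventually (\<lambda>n. L (s n) \<ge> R + 1) sequentially"
      using esc by (auto simp: filterlim_at_top)
    then obtain n where "L (s n) \<ge> R + 1" by (auto simp: eventually_sequentially)
    then show False using s(1)[of n] by simp
  qed
next
  fix s :: "nat \<Rightarrow> 'a"
  assume bdd: "\<forall>R. bounded {y. L y \<le> R}" and no: "\<nexists>p. seq_accumulation_point s p"
  show "filterlim (\<lambda>n. L (s n)) at_top sequentially"
    unfolding filterlim_at_top_dense
  proof
    fix R
    have "finite {n. L (s n) \<le> R}"
    proof (rule ccontr)
      assume "infinite {n. L (s n) \<le> R}"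
      then obtain r :: "nat \<Rightarrow> nat" where r: "strict_mono r" "\<And>n. L (s (r n)) \<le> R"
        using infinite_enumerate by (metis mem_Collect_eq)
      have "bounded (range (s \<circ> r))"
        by (rule bounded_subset[of "{y. L y \<le> R}"]) (use bdd r in auto)
      then obtain p r' where p: "strict_mono (r' :: nat \<Rightarrow> nat)" "((s \<circ> r) \<circ> r') \<longlonglongrightarrow> p"
        using bounded_imp_convergent_subsequence by blast
      have "seq_accumulation_point s p"
        unfolding seq_accumulation_point_def
      proof safe
        fix U assume "open U" "p \<in> U" and fin: "finite {n. s n \<in> U}"
        then have "eventually (\<lambda>n. s (r (r' n)) \<in> U) sequentially"
          using topological_tendstoD[OF p(2)] by simp
        then obtain N where N: "\<And>n. n \<ge> N \<Longrightarrow> s (r (r' n)) \<in> U" by (auto simp: eventually_sequentially)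
        have "inj (r \<circ> r')" using r p by (simp add: strict_mono_o strict_mono_imp_inj_on)
        then have "infinite ((r \<circ> r') ` {N..})"
          by (metis finite_imageD infinite_Ici inj_on_subset subset_UNIV)
        moreover have "(r \<circ> r') ` {N..} \<subseteq> {n. s n \<in> U}" using N by auto
        ultimately show False using fin finite_subset by blast
      qed
      then show False using no by blast
    qed
    then have "eventually (\<lambda>n. n \<notin> {n. L (s n) \<le> R}) sequentially"
      by (simp add: cofinite_eq_sequentially[symmetric] eventually_cofinite)
    then show "eventually (\<lambda>n. R < L (s n)) sequentially" by (simp add: not_le)
  qed
qed

lemma fibers_escape_iff:
  "fibers_escape \<Phi> B \<longleftrightarrow> (\<forall>R. bounded {y. \<exists>t. norm (\<Phi> (t *\<^sub>R B y + y, t)) \<le> R})"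
proof -
  define L where "L y = line_norm (graph_line \<Phi> B y)" for y
  have L: "L y = infdist 0 (range (\<lambda>t. \<Phi> (t *\<^sub>R B y + y, t)))" for y
    by (simp add: L_def line_norm_def graph_line_def)
  have le: "L y \<le> norm (\<Phi> (t *\<^sub>R B y + y, t))" for y t
    using infdist_le[of "\<Phi> (t *\<^sub>R B y + y, t)" "range (\<lambda>t. \<Phi> (t *\<^sub>R B y + y, t))" 0] by (simp add: L)
  \<comment> \<open>The distance is an infimum over the line; \<open>R + 1\<close> leaves room to
    pick a point of the line without showing that the infimum is attained.\<close>
  have ge: "\<exists>t. norm (\<Phi> (t *\<^sub>R B y + y, t)) \<le> R + 1" if "L y \<le> R" for y R
  proof -
    define S where "S = range (\<lambda>t. \<Phi> (t *\<^sub>R B y + y, t))"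
    have "(INF x\<in>S. dist 0 x) < R + 1"
      using that infdist_notempty[of S 0] unfolding L S_def by simp
    then have "\<exists>x\<in>S. dist 0 x < R + 1"
      by (subst (asm) cINF_less_iff) (auto simp: S_def intro!: bdd_belowI2[of _ 0])
    then show ?thesis by (auto simp: S_def intro: less_imp_le)
  qed
  have "fibers_escape \<Phi> B \<longleftrightarrow> (\<forall>R. bounded {y. L y \<le> R})"
    using escaping_iff_bounded_sublevels[of L] by (simp add: fibers_escape_def L_def)
  also have "\<dots> \<longleftrightarrow> (\<forall>R. bounded {y. \<exists>t. norm (\<Phi> (t *\<^sub>R B y + y, t)) \<le> R})"
  proof safe
    fix R assume "\<forall>R. bounded {y. L y \<le> R}"
    then show "bounded {y. \<exists>t. norm (\<Phi> (t *\<^sub>R B y + y, t)) \<le> R}"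
      by (rule allE[of _ R], elim bounded_subset) (use le order_trans in blast)
  next
    fix R assume "\<forall>R. bounded {y. \<exists>t. norm (\<Phi> (t *\<^sub>R B y + y, t)) \<le> R}"
    then show "bounded {y. L y \<le> R}"
      by (rule allE[of _ "R + 1"], elim bounded_subset) (use ge in blast)
  qed
  finally show ?thesis .
qed

text \<open>The image is open by invariance of domain and closed by properness, hence everything by
  connectedness.\<close>

lemma proper_injective_imp_surj:
  fixes f :: "'a::euclidean_space \<Rightarrow> 'a"
  assumes f: "continuous_on UNIV f" "inj f" and proper: "\<And>R. bounded (f -` cball 0 R)"
  shows "surj f"
proof -
  have "open (range f)" by (rule invariance_of_domain) (use f in auto)
  moreover have "closed (range f)"
    unfolding closed_sequential_limits
  proof safe
    fix s l assume s: "\<forall>n. s n \<in> range f" "s \<longlonglongrightarrow> l"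
    then obtain R where R: "\<And>n. norm (s n) \<le> R" using convergent_imp_bounded[of s l] by (auto simp: bounded_iff)
    have "compact (f -` cball 0 R)"
      using proper closed_vimage[OF closed_cball f(1)] by (simp add: compact_eq_bounded_closed)
    then have "closed (f ` (f -` cball 0 R))"
      using f by (metis compact_continuous_image compact_imp_closed continuous_on_subset subset_UNIV)
    moreover have "s n \<in> f ` (f -` cball 0 R)" for n using s(1) R[of n] by (auto simp: image_iff)
    ultimately show "l \<in> range f" using s(2) closed_sequentially by blast
  qed
  ultimately show ?thesis using clopen[of "range f"] by auto
qed

lemma continuous_bijection_inverse:
  fixes f :: "'a::euclidean_space \<Rightarrow> 'a"
  assumes "continuous_on UNIV f" "bij f"
  shows "continuous_on UNIV (inv f)"
proof -
  have "open (f ` T)" if "open T" for T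
    using that assms by (intro invariance_of_domain) (auto intro: continuous_on_subset inj_on_subset bij_is_inj)
  then have "open (inv f -` T)" if "open T" for T
    using that assms(2) by (simp add: bij_vimage_eq_inv_image bij_imp_bij_inv inv_inv_eq)
  then show ?thesis by (simp add: continuous_on_open_vimage)
qed

section \<open>Fibrations by graphs\<close>

locale orthonormal_frame =
  fixes a e1 e2 n :: "real^3"
  assumes unit: "norm e1 = 1" "norm e2 = 1" "norm n = 1"
    and orthogonal: "e1 \<bullet> e2 = 0" "e1 \<bullet> n = 0" "e2 \<bullet> n = 0"
begin

definition lin :: "(real^2) \<times> real \<Rightarrow> real^3" where
  "lin p = fst p $ 1 *\<^sub>R e1 + fst p $ 2 *\<^sub>R e2 + snd p *\<^sub>R n"

definition Phi :: "(real^2) \<times> real \<Rightarrow> real^3" where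
  "Phi p = a + lin p"

definition coord :: "real^3 \<Rightarrow> (real^2) \<times> real" where
  "coord x = ((\<chi> i. x \<bullet> (if i = 1 then e1 else e2)), x \<bullet> n)"

lemma inner_frame [simp]:
  "e1 \<bullet> e1 = 1" "e2 \<bullet> e2 = 1" "n \<bullet> n = 1" "e1 \<bullet> e2 = 0" "e1 \<bullet> n = 0" "e2 \<bullet> n = 0"
  "e2 \<bullet> e1 = 0" "n \<bullet> e1 = 0" "n \<bullet> e2 = 0"
  using unit orthogonal by (simp_all add: norm_eq_1 inner_commute)

lemma linear_lin: "linear lin"
  by (rule linearI) (simp_all add: lin_def algebra_simps)

lemmas lin_simps = linear_add[OF linear_lin] linear_diff[OF linear_lin] linear_cmul[OF linear_lin]
  linear_0[OF linear_lin] linear_neg[OF linear_lin]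

lemma continuous_lin [continuous_intros]: "continuous_on S f \<Longrightarrow> continuous_on S (\<lambda>x. lin (f x))"
  unfolding lin_def by (intro continuous_intros)

lemma continuous_coord [continuous_intros]: "continuous_on S f \<Longrightarrow> continuous_on S (\<lambda>x. coord (f x))"
  unfolding coord_def by (intro continuous_intros continuous_on_vec_lambda)

lemma coord_lin [simp]: "coord (lin p) = p"
  by (cases p) (simp add: coord_def lin_def vec_eq_iff forall_2 inner_add_left)

lemma lin_coord [simp]: "lin (coord x) = x"
  using orthonormal_expansion[OF unit orthogonal, of x] by (simp add: lin_def coord_def)

lemma lin_inner_n [simp]: "lin p \<bullet> n = snd p"
  by (simp add: lin_def inner_add_left)

lemma inner_lin: "lin p \<bullet> lin q = p \<bullet> q"
proof -
  have "p \<bullet> q = fst p $ 1 * fst q $ 1 + fst p $ 2 * fst q $ 2 + snd p * snd q"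
    by (cases p, cases q) (simp add: inner_vec_def[where 'b = 2] sum_2)
  then show ?thesis by (simp add: lin_def inner_add_left inner_add_right)
qed

lemma norm_lin [simp]: "norm (lin p) = norm p"
  by (simp add: norm_eq_sqrt_inner inner_lin)

lemma lin_eq_iff [simp]: "lin p = lin q \<longleftrightarrow> p = q"
  by (metis coord_lin)

lemma Phi_eq: "Phi = (\<lambda>(y, t). a + (y $ 1) *\<^sub>R e1 + (y $ 2) *\<^sub>R e2 + t *\<^sub>R n)"
  by (auto simp: Phi_def lin_def add.assoc)

lemma euclidean_identification_Phi: "euclidean_identification Phi"
  unfolding euclidean_identification_def Phi_eq using unit orthogonal by blast

lemma Phi_line: "Phi (t *\<^sub>R v + y, t) = Phi (y, 0) + t *\<^sub>R lin (v, 1)"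
  by (simp add: Phi_def lin_simps(3)[symmetric] lin_simps(1)[symmetric] add.assoc add.commute[of y])

lemma graph_line_Phi:
  "graph_line Phi B y = (range (\<lambda>t. Phi (y, 0) + t *\<^sub>R lin (B y, 1)), sgn (lin (B y, 1)))"
  using Phi_line[of 1 "B y" y] by (simp add: graph_line_def Phi_line)

lemma fibers_escape_Phi_iff:
  "fibers_escape Phi B \<longleftrightarrow> (\<forall>R. bounded {y. \<exists>t. norm (t *\<^sub>R B y + y, t) \<le> R})"
proof -
  have 1: "norm (Phi p) \<le> norm a + norm p" and 2: "norm p \<le> norm a + norm (Phi p)" for p
    using norm_triangle_ineq[of a "lin p"] norm_triangle_ineq[of "- a" "Phi p"] by (simp_all add: Phi_def)
  have 3: "{y. \<exists>t. norm (t *\<^sub>R B y + y, t) \<le> R} \<subseteq> {y. \<exists>t. norm (Phi (t *\<^sub>R B y + y, t)) \<le> norm a + R}" for R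
    by (intro Collect_mono ex_mono impI order_trans[OF 1]) simp
  have 4: "{y. \<exists>t. norm (Phi (t *\<^sub>R B y + y, t)) \<le> R} \<subseteq> {y. \<exists>t. norm (t *\<^sub>R B y + y, t) \<le> norm a + R}" for R
    by (intro Collect_mono ex_mono impI order_trans[OF 2]) simp
  show ?thesis unfolding fibers_escape_iff
    by (intro iffI allI, (rule bounded_subset[OF _ 3], erule spec), (rule bounded_subset[OF _ 4], erule spec))
qed

end

lemma euclidean_identificationE:
  assumes "euclidean_identification \<Phi>"
  obtains a e1 e2 n where "orthonormal_frame e1 e2 n" "\<Phi> = orthonormal_frame.Phi a e1 e2 n"
proof -
  obtain a e1 e2 n where *: "norm e1 = 1" "norm e2 = 1" "norm n = 1"
      "e1 \<bullet> e2 = 0" "e1 \<bullet> n = 0" "e2 \<bullet> n = 0"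
      "\<Phi> = (\<lambda>(y, t). a + (y $ 1) *\<^sub>R e1 + (y $ 2) *\<^sub>R e2 + t *\<^sub>R n)"
    using assms unfolding euclidean_identification_def by blast
  then interpret orthonormal_frame a e1 e2 n by unfold_locales
  show thesis
    by (rule that[of e1 e2 n a]) (use * Phi_eq in \<open>simp_all add: orthonormal_frame_axioms\<close>)
qed

text \<open>In \<open>kernel\<close>, a relation with \<open>d \<noteq> 0\<close> would make the
  graphs over \<open>y\<close> and \<open>z\<close> meet at height \<open>c / d\<close>, and one
  with \<open>d = 0\<close>, \<open>c \<noteq> 0\<close> would make them parallel.
  \<open>escape\<close> says that a ball is met only by graphs with base points in a bounded
  set.\<close>

locale skew_graph_family = orthonormal_frame +
  fixes B :: "real^2 \<Rightarrow> real^2"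
  assumes continuous_B: "continuous_on UNIV B"
    and kernel: "\<And>y z c d. c *\<^sub>R (B y - B z) + d *\<^sub>R (y - z) = 0 \<Longrightarrow> y \<noteq> z \<Longrightarrow> c = 0 \<and> d = 0"
    and escape: "\<And>R. bounded {y. \<exists>t. norm (t *\<^sub>R B y + y, t) \<le> R}"
begin

definition flow :: "(real^2) \<times> real \<Rightarrow> (real^2) \<times> real" where
  "flow p = (snd p *\<^sub>R B (fst p) + fst p, snd p)"

lemma B_eqD: "B y = B z \<Longrightarrow> y = z"
  using kernel[of 1 y z 0] by auto

lemma continuous_flow: "continuous_on UNIV flow"
  unfolding flow_def
  by (intro continuous_intros continuous_on_compose2[OF continuous_B]) auto

text \<open>Injectivity is \<open>kernel\<close> with coefficients \<open>snd p\<close> and 1;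
  \<open>escape\<close> makes \<open>flow\<close> proper, which yields surjectivity.\<close>

lemma bij_flow: "bij flow"
proof -
  have inj: "inj flow"
  proof (rule injI)
    fix p q assume *: "flow p = flow q"
    then have snd: "snd p = snd q" by (simp add: flow_def)
    moreover have "snd p *\<^sub>R B (fst p) + fst p = snd p *\<^sub>R B (fst q) + fst q"
      using * by (simp add: flow_def snd)
    then have "snd p *\<^sub>R (B (fst p) - B (fst q)) + 1 *\<^sub>R (fst p - fst q) = 0"
      by (simp add: algebra_simps)
    then have "fst p = fst q" using kernel one_neq_zero by blast
    then show "p = q" using * by (simp add: flow_def prod_eq_iff)
  qed
  moreover have "surj flow"
  proof (rule proper_injective_imp_surj[OF continuous_flow inj])
    fix R
    have "flow -` cball 0 R \<subseteq> {y. \<exists>t. norm (t *\<^sub>R B y + y, t) \<le> R} \<times> cball 0 R"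
    proof
      fix p assume "p \<in> flow -` cball 0 R"
      then have *: "norm (snd p *\<^sub>R B (fst p) + fst p, snd p) \<le> R" by (simp add: flow_def)
      then have "norm (snd p) \<le> R"
        using norm_snd_le[of "snd p" "snd p *\<^sub>R B (fst p) + fst p"] by linarith
      then show "p \<in> {y. \<exists>t. norm (t *\<^sub>R B y + y, t) \<le> R} \<times> cball 0 R"
        using * by (auto simp: mem_Times_iff)
    qed
    then show "bounded (flow -` cball 0 R)"
      by (rule bounded_subset[OF bounded_Times[OF escape bounded_cball]])
  qed
  ultimately show ?thesis by (simp add: bij_def)
qed

text \<open>The base point of the graph through \<open>x\<close>. Its level sets are exactly the
  fibers, and its continuity carries that of \<open>B\<close> over to the direction field.\<close>

definition foot :: "real^3 \<Rightarrow> real^2" where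
  "foot x = fst (inv flow (coord (x - a)))"

lemma continuous_foot: "continuous_on UNIV foot"
  unfolding foot_def
  by (intro continuous_intros continuous_on_compose2[OF continuous_bijection_inverse[OF continuous_flow bij_flow]]) auto

lemma Phi_flow: "Phi (y, 0) + t *\<^sub>R lin (B y, 1) = Phi (flow (y, t))"
  by (simp add: flow_def Phi_line[symmetric])

lemma on_graph_line_iff: "x \<in> fst (graph_line Phi B y) \<longleftrightarrow> foot x = y"
proof
  assume "x \<in> fst (graph_line Phi B y)"
  then obtain t where "x = Phi (flow (y, t))" by (auto simp: graph_line_Phi Phi_flow)
  then show "foot x = y" using bij_flow by (simp add: foot_def Phi_def bij_is_inj)
next
  assume *: "foot x = y"
  define p where "p = inv flow (coord (x - a))"
  have "flow p = coord (x - a)" using bij_flow by (simp add: p_def bij_is_surj surj_f_inv_f)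
  then have "x = Phi (flow p)" by (simp add: Phi_def)
  moreover have "p = (y, snd p)" using * by (simp add: p_def foot_def prod_eq_iff)
  ultimately have "x = Phi (flow (y, snd p))" by metis
  then show "x \<in> fst (graph_line Phi B y)" by (auto simp: graph_line_Phi Phi_flow)
qed

lemma lin_nonzero [simp]: "lin (v, 1) \<noteq> 0"
  by (metis inner_zero_left lin_inner_n snd_conv zero_neq_one)

lemma graph_line_eq:
  "graph_line Phi B y = (range (\<lambda>t. Phi (y, 0) + t *\<^sub>R sgn (lin (B y, 1))), sgn (lin (B y, 1)))"
  by (simp add: graph_line_Phi range_line_sgn)

text \<open>Both vectors have positive component along \<open>n\<close>, which rules out opposite
  directions; comparing last coordinates then makes the scaling factors equal.\<close>

lemma sgn_lin_eqD:
  assumes "sgn (lin (v, 1)) = sgn (lin (w, 1)) \<or> sgn (lin (v, 1)) = - sgn (lin (w, 1))"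
  shows "v = w"
proof -
  define s t where "s = 1 / norm (v, 1::real)" and "t = 1 / norm (w, 1::real)"
  have pos: "s > 0" "t > 0" by (simp_all add: s_def t_def zero_prod_def)
  have eq: "sgn (lin (v, 1)) = lin (s *\<^sub>R (v, 1))" "sgn (lin (w, 1)) = lin (t *\<^sub>R (w, 1))"
    unfolding lin_simps by (simp_all add: s_def t_def sgn_div_norm inverse_eq_divide)
  have "s *\<^sub>R (v, 1) = t *\<^sub>R (w, 1::real) \<or> s *\<^sub>R (v, 1::real) = - (t *\<^sub>R (w, 1))"
    using assms unfolding eq lin_simps(5)[symmetric] lin_eq_iff .
  then show ?thesis using pos by auto
qed

lemma skew_line_fibration_graphs: "skew_line_fibration (range (graph_line Phi B))"
  unfolding skew_line_fibration_def
proof (intro conjI)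
  show "range (graph_line Phi B) \<subseteq> oriented_lines"
    unfolding oriented_lines_def graph_line_eq by (auto simp: norm_sgn)
  have ex1: "\<exists>!l. l \<in> range (graph_line Phi B) \<and> x \<in> fst l" for x
    by (rule ex1I[of _ "graph_line Phi B (foot x)"]) (auto simp: on_graph_line_iff)
  then show "\<forall>x. \<exists>!l. l \<in> range (graph_line Phi B) \<and> x \<in> fst l" by blast
  have "fiber_direction (range (graph_line Phi B)) x = sgn (lin (B (foot x), 1))" for x
  proof -
    have "(THE l. l \<in> range (graph_line Phi B) \<and> x \<in> fst l) = graph_line Phi B (foot x)"
      by (rule the1_equality[OF ex1]) (simp add: on_graph_line_iff)
    then show ?thesis by (simp add: fiber_direction_def graph_line_eq)
  qed
  moreover have "continuous_on UNIV (\<lambda>x. sgn (lin (B (foot x), 1)))"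
    unfolding sgn_div_norm
    by (intro continuous_intros continuous_on_compose2[OF continuous_B] continuous_foot) (auto simp: zero_prod_def)
  ultimately show "continuous_on UNIV (fiber_direction (range (graph_line Phi B)))" by simp
  show "\<forall>l\<in>range (graph_line Phi B). \<forall>m\<in>range (graph_line Phi B). l \<noteq> m \<longrightarrow> skew_lines l m"
  proof (intro ballI impI)
    fix l m assume "l \<in> range (graph_line Phi B)" "m \<in> range (graph_line Phi B)" "l \<noteq> m"
    then obtain y z where yz: "l = graph_line Phi B y" "m = graph_line Phi B z" "y \<noteq> z" by auto
    have "\<not> parallel_lines l m"
      using sgn_lin_eqD[of "B y" "B z"] B_eqD[of y z] yz by (auto simp: parallel_lines_def graph_line_eq)
    moreover have "fst l \<inter> fst m = {}" using yz by (auto simp: on_graph_line_iff)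
    ultimately show "skew_lines l m" by (simp add: skew_lines_def)
  qed
qed

end

lemma graph_presentationE:
  assumes "graph_presentation M \<Phi> B"
  obtains a e1 e2 n where "skew_graph_family e1 e2 n B" "\<Phi> = orthonormal_frame.Phi a e1 e2 n"
    "M = range (graph_line \<Phi> B)" "B 0 = 0"
proof -
  have \<Phi>: "euclidean_identification \<Phi>" and B: "continuous_on UNIV B" "trivial_kernels B" "fibers_escape \<Phi> B" "B 0 = 0"
    and M: "M = range (graph_line \<Phi> B)"
    using assms by (auto simp: graph_presentation_def)
  obtain a e1 e2 n where *: "orthonormal_frame e1 e2 n" "\<Phi> = orthonormal_frame.Phi a e1 e2 n"
    using \<Phi> by (rule euclidean_identificationE)
  interpret orthonormal_frame a e1 e2 n by (rule *)
  have "skew_graph_family e1 e2 n B"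
  proof unfold_locales
    fix y z c d assume "c *\<^sub>R (B y - B z) + d *\<^sub>R (y - z) = 0" "y \<noteq> z"
    then show "c = 0 \<and> d = 0" using B(2) unfolding trivial_kernels_iff by blast
  qed (use B in \<open>simp_all add: * fibers_escape_Phi_iff\<close>)
  then show thesis using that * M B(4) by blast
qed

lemma graph_presentation_imp_skew_line_fibration:
  assumes "graph_presentation M \<Phi> B"
  shows "skew_line_fibration M"
  using assms by (metis graph_presentationE skew_graph_family.skew_line_fibration_graphs)

section \<open>From a fibration to a presentation by graphs\<close>

lemma skew_line_fibration_direction_field:
  assumes M: "skew_line_fibration M"
  defines "V \<equiv> fiber_direction M"
  shows "skew_direction_field V" "M = range (\<lambda>x. (range (\<lambda>t. x + t *\<^sub>R V x), V x))"
proof -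
  have lines: "M \<subseteq> oriented_lines" and ex1: "\<And>x. \<exists>!l. l \<in> M \<and> x \<in> fst l"
    and cont: "continuous_on UNIV V" and skew: "\<And>l m. l \<in> M \<Longrightarrow> m \<in> M \<Longrightarrow> l \<noteq> m \<Longrightarrow> skew_lines l m"
    using M by (auto simp: skew_line_fibration_def V_def)
  \<comment> \<open>Uniqueness of the fiber through \<open>x\<close> resolves the definite
    description, and the base point of the line may be moved to \<open>x\<close>.\<close>
  have fiber: "l = (range (\<lambda>t. x + t *\<^sub>R V x), V x)" "norm (V x) = 1" if l: "l \<in> M" "x \<in> fst l" for l x
  proof -
    have "(THE l. l \<in> M \<and> x \<in> fst l) = l" by (rule the1_equality[OF ex1]) (simp add: l)
    then have V: "V x = snd l" by (simp add: V_def fiber_direction_def)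
    have "l \<in> oriented_lines" using lines l(1) by blast
    then obtain p u where pu: "l = (range (\<lambda>t. p + t *\<^sub>R u), u)" "norm u = 1"
      unfolding oriented_lines_def by blast
    then obtain s where s: "x = p + s *\<^sub>R u" using l(2) by auto
    have "range (\<lambda>t. x + t *\<^sub>R u) = range (\<lambda>t. p + t *\<^sub>R u)"
      unfolding s by (rule range_line_shift)
    then show "l = (range (\<lambda>t. x + t *\<^sub>R V x), V x)" "norm (V x) = 1" using V pu by simp_all
  qed
  have in_M: "(range (\<lambda>t. x + t *\<^sub>R V x), V x) \<in> M" for x
    using ex1[of x] fiber(1) by metis
  have mem: "x + t *\<^sub>R V x \<in> fst (range (\<lambda>t. x + t *\<^sub>R V x), V x)" for x t
    by (auto intro: range_eqI[of _ _ t])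
  show "skew_direction_field V"
  proof
    fix x y :: "real^3" and t :: real
    show "norm (V x) = 1" using fiber(2)[OF in_M, of x x] mem[of x 0] by simp
    show "V (x + t *\<^sub>R V x) = V x" using fiber(1)[OF in_M mem[of x t]] by simp
    assume "V x = V y \<or> V x = - V y"
    then have "\<not> skew_lines (range (\<lambda>t. x + t *\<^sub>R V x), V x) (range (\<lambda>t. y + t *\<^sub>R V y), V y)"
      by (auto simp: skew_lines_def parallel_lines_def)
    then have "range (\<lambda>t. x + t *\<^sub>R V x) = range (\<lambda>t. y + t *\<^sub>R V y)"
      using skew in_M by blast
    moreover have "y \<in> range (\<lambda>t. y + t *\<^sub>R V y)" by (rule range_eqI[of _ _ 0]) simp
    ultimately show "\<exists>t. y = x + t *\<^sub>R V x" by blast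
  qed (rule cont)
  show "M = range (\<lambda>x. (range (\<lambda>t. x + t *\<^sub>R V x), V x))"
  proof safe
    fix L u assume l: "(L, u) \<in> M"
    then obtain p where "L = range (\<lambda>t. p + t *\<^sub>R u)" using lines by (auto simp: oriented_lines_def)
    then have "p \<in> fst (L, u)" by (auto intro: range_eqI[of _ _ 0])
    then show "(L, u) \<in> range (\<lambda>x. (range (\<lambda>t. x + t *\<^sub>R V x), V x))"
      using fiber(1)[OF l] by blast
  qed (rule in_M)
qed

text \<open>The base plane passes through the point \<open>a\<close> from
  \<open>central_direction\<close>, perpendicular to the fiber there. All fibers cross it
  transversally and in the same sense, so they are graphs over it, oriented upwards.\<close>

lemma skew_line_fibration_imp_graph_presentation:
  assumes "skew_line_fibration M"
  obtains \<Phi> B where "graph_presentation M \<Phi> B"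
proof -
  define V where "V = fiber_direction M"
  have M: "M = range (\<lambda>x. (range (\<lambda>t. x + t *\<^sub>R V x), V x))"
    using skew_line_fibration_direction_field[OF assms] by (simp add: V_def)
  interpret V: skew_direction_field V
    using skew_line_fibration_direction_field[OF assms] by (simp add: V_def)
  obtain a where pos: "\<And>x. V x \<bullet> V a > 0" using V.central_direction by blast
  define n where "n = V a"
  obtain e1 e2 where "norm e1 = 1" "norm e2 = 1" "n \<bullet> e1 = 0" "n \<bullet> e2 = 0" "e1 \<bullet> e2 = 0"
    using orthonormal_completion[of n] V.unit by (auto simp: n_def)
  then interpret orthonormal_frame a e1 e2 n
    by unfold_locales (simp_all add: n_def inner_commute)
  have pos: "V x \<bullet> n > 0" for x using pos by (simp add: n_def)
  define W where "W y = V (Phi (y, 0))" for y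
  \<comment> \<open>The slope: the direction at the base point rescaled to have component 1 along
    \<open>n\<close>.\<close>
  define B where "B y = fst (coord (W y)) /\<^sub>R (W y \<bullet> n)" for y
  have Wn: "W y \<bullet> n > 0" for y using pos by (simp add: W_def)
  have lin_B: "lin (B y, 1) = W y /\<^sub>R (W y \<bullet> n)" for y
  proof -
    have "snd (coord (W y)) = W y \<bullet> n" by (simp add: coord_def)
    then have "(B y, 1) = coord (W y) /\<^sub>R (W y \<bullet> n)" using Wn[of y] by (simp add: B_def prod_eq_iff)
    then show ?thesis by (metis lin_coord lin_simps(3))
  qed
  have line_eq: "Phi (y, 0) + t *\<^sub>R lin (B y, 1) = Phi (y, 0) + (t / (W y \<bullet> n)) *\<^sub>R W y" for y t
    by (simp add: lin_B divide_inverse)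
  have sgn_W: "sgn (lin (B y, 1)) = W y" for y
  proof -
    have "norm (W y) = 1" by (simp add: W_def)
    then show ?thesis unfolding lin_B using Wn[of y] by (simp add: sgn_scaleR) (simp add: sgn_div_norm)
  qed
  have graph: "graph_line Phi B y = (range (\<lambda>t. Phi (y, 0) + t *\<^sub>R W y), W y)" for y
  proof -
    have "lin (B y, 1) \<noteq> 0" by (metis inner_zero_left lin_inner_n snd_conv zero_neq_one)
    then show ?thesis using range_line_sgn[of "lin (B y, 1)" "Phi (y, 0)"] by (simp add: graph_line_Phi sgn_W)
  qed
  have Phi_n: "Phi p \<bullet> n = a \<bullet> n + snd p" for p by (simp add: Phi_def inner_add_left)
  have W_inj: "y = z" if yz: "W y = W z" for y z
  proof -
    obtain t where t: "Phi (z, 0) = Phi (y, 0) + t *\<^sub>R W y"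
      using V.parallel[of "Phi (y, 0)" "Phi (z, 0)"] yz by (auto simp: W_def)
    have "Phi (z, 0) \<bullet> n = Phi (y, 0) \<bullet> n" by (simp add: Phi_n)
    then have "t = 0" using t Wn[of y] by (simp add: inner_add_left)
    then show ?thesis using t by (simp add: Phi_def)
  qed
  \<comment> \<open>The signed time at which the fiber, followed from \<open>x\<close>, reaches the
    base plane; \<open>foot x\<close> is the point reached.\<close>
  define tau where "tau x = - ((x - a) \<bullet> n) / (V x \<bullet> n)" for x
  define foot where "foot x = fst (coord (x + tau x *\<^sub>R V x - a))" for x
  have foot: "x + tau x *\<^sub>R V x = Phi (foot x, 0)" for x
  proof -
    have "snd (coord (x + tau x *\<^sub>R V x - a)) = 0"
      using pos[of x] by (simp add: coord_def tau_def inner_add_left inner_diff_left)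
    then have "coord (x + tau x *\<^sub>R V x - a) = (foot x, 0)" by (simp add: foot_def prod_eq_iff)
    then show ?thesis by (metis Phi_def add.commute diff_add_cancel lin_coord)
  qed
  have foot_line: "foot x = y" if "x = Phi (y, 0) + t *\<^sub>R W y" for x y t
  proof -
    have "V x = W y" by (simp add: that W_def)
    moreover have "Phi (foot x, 0) \<bullet> n = Phi (y, 0) \<bullet> n" by (simp add: Phi_n)
    ultimately have "(t + tau x) * (W y \<bullet> n) = 0"
      using that by (auto simp: inner_add_left algebra_simps simp flip: foot)
    then have "tau x = - t" using Wn[of y] by (simp add: eq_neg_iff_add_eq_0 add.commute)
    then show ?thesis
      using foot[of x] that \<open>V x = W y\<close> by (simp add: Phi_def)
  qed
  have "continuous_on UNIV B"
    unfolding B_def W_def Phi_def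
    by (intro continuous_intros continuous_on_compose2[OF V.continuous]) (use pos in \<open>auto simp: less_imp_neq[symmetric]\<close>)
  moreover have "B 0 = 0"
  proof -
    have "Phi (0, 0) = a" by (simp add: Phi_def lin_def)
    then have W0: "W 0 = n" by (simp add: W_def n_def)
    show ?thesis unfolding B_def W0 by (simp add: coord_def vec_eq_iff)
  qed
  moreover have "M = range (graph_line Phi B)"
  proof -
    have "(range (\<lambda>t. x + t *\<^sub>R V x), V x) = graph_line Phi B (foot x)" for x
    proof -
      have W: "W (foot x) = V x" by (simp add: W_def flip: foot)
      show ?thesis by (simp add: graph W range_line_shift flip: foot)
    qed
    moreover have "graph_line Phi B y = (range (\<lambda>t. Phi (y, 0) + t *\<^sub>R V (Phi (y, 0))), V (Phi (y, 0)))" for y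
      by (simp add: graph W_def)
    ultimately show ?thesis unfolding M by (metis (no_types, lifting) image_eqI image_subsetI subset_antisym UNIV_I)
  qed
  moreover have "trivial_kernels B"
    unfolding trivial_kernels_iff
  proof (intro allI impI)
    fix y z c d assume ne: "y \<noteq> z" and eq: "c *\<^sub>R (B y - B z) + d *\<^sub>R (y - z) = 0"
    have "d = 0"
    proof (rule ccontr)
      assume d: "d \<noteq> 0"
      \<comment> \<open>The relation says that the two graphs have a common point at height
        \<open>c / d\<close>.\<close>
      have "(c / d) *\<^sub>R B y + y = (c / d) *\<^sub>R B z + z"
      proof -
        have "(1 / d) *\<^sub>R (c *\<^sub>R (B y - B z) + d *\<^sub>R (y - z)) = 0" using eq by simp
        then show ?thesis using d by (simp add: algebra_simps)
      qed
      then have "Phi (y, 0) + (c / d / (W y \<bullet> n)) *\<^sub>R W y = Phi (z, 0) + (c / d / (W z \<bullet> n)) *\<^sub>R W z"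
        by (simp only: line_eq[symmetric] Phi_line[symmetric])
      then have "W y = W z" unfolding W_def by (rule V.meet)
      then show False using W_inj ne by blast
    qed
    moreover have "c = 0"
    proof (rule ccontr)
      assume "c \<noteq> 0"
      then have "B y = B z" using eq \<open>d = 0\<close> by simp
      then have "W y = W z" by (metis sgn_W)
      then show False using W_inj ne by blast
    qed
    ultimately show "c = 0 \<and> d = 0" by simp
  qed
  moreover have "fibers_escape Phi B"
    unfolding fibers_escape_iff
  proof
    fix R
    \<comment> \<open>Base points of fibers that meet a closed ball lie in its image under the
      continuous map \<open>foot\<close>, which is compact.\<close>
    have "continuous_on UNIV foot"
      unfolding foot_def tau_def
      by (intro continuous_intros V.continuous) (use pos in \<open>auto simp: less_imp_neq[symmetric]\<close>)
    then have "bounded (foot ` cball 0 R)"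
      by (metis compact_cball compact_continuous_image compact_imp_bounded continuous_on_subset subset_UNIV)
    moreover have "{y. \<exists>t. norm (Phi (t *\<^sub>R B y + y, t)) \<le> R} \<subseteq> foot ` cball 0 R"
    proof safe
      fix y t assume "norm (Phi (t *\<^sub>R B y + y, t)) \<le> R"
      moreover have "foot (Phi (t *\<^sub>R B y + y, t)) = y"
        by (rule foot_line) (simp only: Phi_line line_eq)
      ultimately show "y \<in> foot ` cball 0 R" by (metis image_eqI mem_cball_0)
    qed
    ultimately show "bounded {y. \<exists>t. norm (Phi (t *\<^sub>R B y + y, t)) \<le> R}" by (rule bounded_subset)
  qed
  ultimately show thesis
    by (intro that[of Phi B]) (simp add: graph_presentation_def euclidean_identification_Phi)
qed

section \<open>Great circles\<close>

definition unit_circle_lift :: "'a::real_inner \<Rightarrow> 'a \<Rightarrow> ('a \<times> 'a) set" where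
  "unit_circle_lift p v = range (\<lambda>t. (cos t *\<^sub>R p + sin t *\<^sub>R v, cos t *\<^sub>R v - sin t *\<^sub>R p))"

text \<open>The oriented unit circle in the plane spanned by \<open>X\<close> and \<open>Y\<close>; it turns from \<open>X\<close> towards \<open>Y\<close>.\<close>

definition span_circle :: "'a::real_inner \<Rightarrow> 'a \<Rightarrow> ('a \<times> 'a) set" where
  "span_circle X Y = {(p, v). norm p = 1 \<and> norm v = 1 \<and> p \<bullet> v = 0 \<and>
     (\<exists>a b a' b'. p = a *\<^sub>R X + b *\<^sub>R Y \<and> v = a' *\<^sub>R X + b' *\<^sub>R Y \<and> a * b' - b * a' > 0)}"

lemma oriented_great_circles_eq:
  "oriented_great_circles = {unit_circle_lift p v | p v. norm p = 1 \<and> norm v = 1 \<and> p \<bullet> v = 0}"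
  by (simp add: oriented_great_circles_def unit_circle_lift_def)

lemma orthonormal_combination:
  fixes p v :: "'a::real_inner"
  assumes "norm p = 1" "norm v = 1" "p \<bullet> v = 0"
  shows "(c *\<^sub>R p + s *\<^sub>R v) \<bullet> (c' *\<^sub>R p + s' *\<^sub>R v) = c * c' + s * s'"
    and "norm (c *\<^sub>R p + s *\<^sub>R v) = 1 \<longleftrightarrow> c\<^sup>2 + s\<^sup>2 = 1"
proof -
  have *: "p \<bullet> p = 1" "v \<bullet> v = 1" "v \<bullet> p = 0" using assms by (simp_all add: norm_eq_1 inner_commute)
  show "(c *\<^sub>R p + s *\<^sub>R v) \<bullet> (c' *\<^sub>R p + s' *\<^sub>R v) = c * c' + s * s'" for c s c' s'
    using * assms by (simp add: inner_add_left inner_add_right)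
  from this[of c s c s] show "norm (c *\<^sub>R p + s *\<^sub>R v) = 1 \<longleftrightarrow> c\<^sup>2 + s\<^sup>2 = 1"
    by (simp add: norm_eq_1 power2_eq_square)
qed

text \<open>Lagrange's identity gives determinant 1, and then the squared distance between
  \<open>(c', s')\<close> and the quarter turn of \<open>(c, s)\<close> expands to 0.\<close>

lemma positive_orthonormal_pair:
  fixes c s c' s' :: real
  assumes "c\<^sup>2 + s\<^sup>2 = 1" "c'\<^sup>2 + s'\<^sup>2 = 1" "c * c' + s * s' = 0" "c * s' - s * c' > 0"
  shows "c' = - s" "s' = c"
proof -
  have "(c * s' - s * c')\<^sup>2 = (c\<^sup>2 + s\<^sup>2) * (c'\<^sup>2 + s'\<^sup>2) - (c * c' + s * s')\<^sup>2"
    by (simp add: power2_eq_square algebra_simps)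
  then have "(c * s' - s * c')\<^sup>2 = 1" using assms by simp
  then have "c * s' - s * c' = 1" using assms(4) by (simp add: power2_eq_1_iff)
  moreover have "(s' - c)\<^sup>2 + (c' + s)\<^sup>2 = (c\<^sup>2 + s\<^sup>2) + (c'\<^sup>2 + s'\<^sup>2) - 2 * (c * s' - s * c')"
    by (simp add: power2_eq_square algebra_simps)
  ultimately have "(s' - c)\<^sup>2 + (c' + s)\<^sup>2 = 0" using assms by simp
  then show "c' = - s" "s' = c" by (simp_all add: sum_power2_eq_zero_iff)
qed

text \<open>Passing from \<open>X\<close>, \<open>Y\<close> to the orthonormal pair
  \<open>p\<close>, \<open>v\<close> has determinant \<open>D > 0\<close> and so preserves
  orientation; relative to \<open>p\<close>, \<open>v\<close> the positively oriented orthonormal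
  pairs are the rotated ones.\<close>

lemma span_circle_eq:
  assumes "(p, v) \<in> span_circle X Y"
  shows "span_circle X Y = unit_circle_lift p v"
proof -
  from assms obtain a b a' b' where pv: "norm p = 1" "norm v = 1" "p \<bullet> v = 0"
      "p = a *\<^sub>R X + b *\<^sub>R Y" "v = a' *\<^sub>R X + b' *\<^sub>R Y" and det: "a * b' - b * a' > 0"
    by (auto simp: span_circle_def)
  define D where "D = a * b' - b * a'"
  have "D > 0" using det by (simp add: D_def)
  show ?thesis
  proof safe
    fix q w assume "(q, w) \<in> span_circle X Y"
    then obtain x y x' y' where qw: "norm q = 1" "norm w = 1" "q \<bullet> w = 0"
        "q = x *\<^sub>R X + y *\<^sub>R Y" "w = x' *\<^sub>R X + y' *\<^sub>R Y" and det': "x * y' - y * x' > 0"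
      by (auto simp: span_circle_def)
    have XY: "D *\<^sub>R X = b' *\<^sub>R p - b *\<^sub>R v" "D *\<^sub>R Y = a *\<^sub>R v - a' *\<^sub>R p"
      by (simp_all add: D_def pv algebra_simps)
    have expand: "x *\<^sub>R X + y *\<^sub>R Y = ((x * b' - y * a') / D) *\<^sub>R p + ((y * a - x * b) / D) *\<^sub>R v" for x y
    proof -
      have "D *\<^sub>R (x *\<^sub>R X + y *\<^sub>R Y) = x *\<^sub>R (D *\<^sub>R X) + y *\<^sub>R (D *\<^sub>R Y)" by (simp add: algebra_simps)
      also have "\<dots> = (x * b' - y * a') *\<^sub>R p + (y * a - x * b) *\<^sub>R v"
        unfolding XY by (simp add: algebra_simps)
      finally have "(1 / D) *\<^sub>R (D *\<^sub>R (x *\<^sub>R X + y *\<^sub>R Y)) = (1 / D) *\<^sub>R ((x * b' - y * a') *\<^sub>R p + (y * a - x * b) *\<^sub>R v)"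
        by simp
      then show ?thesis using \<open>D > 0\<close> by (simp add: scaleR_add_right)
    qed
    define c s c' s' where "c = (x * b' - y * a') / D" and "s = (y * a - x * b) / D"
      and "c' = (x' * b' - y' * a') / D" and "s' = (y' * a - x' * b) / D"
    have q: "q = c *\<^sub>R p + s *\<^sub>R v" and w: "w = c' *\<^sub>R p + s' *\<^sub>R v"
      using expand qw by (simp_all add: c_def s_def c'_def s'_def)
    \<comment> \<open>Multiplicativity of the determinant under the change of basis.\<close>
    have "(x * b' - y * a') * (y' * a - x' * b) - (y * a - x * b) * (x' * b' - y' * a') = (x * y' - y * x') * D"
      by (simp add: D_def algebra_simps)
    then have "c * s' - s * c' = (x * y' - y * x') * D / (D * D)"
      by (metis c_def s_def c'_def s'_def times_divide_times_eq diff_divide_distrib)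
    then have "c * s' - s * c' > 0" using det' \<open>D > 0\<close> by simp
    moreover have cs: "c\<^sup>2 + s\<^sup>2 = 1" "c'\<^sup>2 + s'\<^sup>2 = 1" "c * c' + s * s' = 0"
      using qw(1-3) unfolding q w orthonormal_combination[OF pv(1-3)] by simp_all
    ultimately have "c' = - s" "s' = c" using positive_orthonormal_pair by blast+
    moreover obtain t where "c = cos t" "s = sin t" using sincos_total_2pi[OF cs(1)] by metis
    ultimately show "(q, w) \<in> unit_circle_lift p v"
      unfolding unit_circle_lift_def by (intro range_eqI[of _ _ t]) (simp add: q w)
  next
    fix q w assume "(q, w) \<in> unit_circle_lift p v"
    then obtain t where q: "q = cos t *\<^sub>R p + sin t *\<^sub>R v" and w: "w = (- sin t) *\<^sub>R p + cos t *\<^sub>R v"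
      by (auto simp: unit_circle_lift_def)
    have "norm q = 1" "norm w = 1" "q \<bullet> w = 0"
      unfolding q w orthonormal_combination[OF pv(1-3)] by simp_all
    moreover have "q = (cos t * a + sin t * a') *\<^sub>R X + (cos t * b + sin t * b') *\<^sub>R Y"
      "w = (cos t * a' - sin t * a) *\<^sub>R X + (cos t * b' - sin t * b) *\<^sub>R Y"
      unfolding q w by (simp_all add: pv(4,5) algebra_simps)
    moreover have "(c * a + s * a') * (c * b' - s * b) - (c * b + s * b') * (c * a' - s * a) = (c\<^sup>2 + s\<^sup>2) * D" for c s
      by (simp add: D_def power2_eq_square algebra_simps)
    from this[of "cos t" "sin t"]
    have "(cos t * a + sin t * a') * (cos t * b' - sin t * b) - (cos t * b + sin t * b') * (cos t * a' - sin t * a) > 0"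
      using \<open>D > 0\<close> by (simp only: sin_cos_squared_add2 mult_1)
    ultimately show "(q, w) \<in> span_circle X Y" unfolding span_circle_def by blast
  qed
qed

lemma self_in_span_circle:
  assumes "norm p = 1" "norm v = 1" "p \<bullet> v = 0"
  shows "(p, v) \<in> span_circle p v"
  unfolding span_circle_def using assms
  by clarsimp (rule exI[of _ 1], rule exI[of _ 0], rule conjI, simp, rule exI[of _ 0], rule exI[of _ 1], simp)

text \<open>Rewriting the circle as a \<open>span_circle\<close> frees it from its initial pair, so
  every pair on it can serve as the start.\<close>

lemma great_circle_rebase:
  assumes "C \<in> oriented_great_circles" "(p, v) \<in> C"
  shows "C = unit_circle_lift p v" "norm p = 1" "norm v = 1" "p \<bullet> v = 0"
proof -
  obtain p0 v0 where *: "C = unit_circle_lift p0 v0" "norm p0 = 1" "norm v0 = 1" "p0 \<bullet> v0 = 0"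
    using assms(1) by (auto simp: oriented_great_circles_eq)
  have C: "C = span_circle p0 v0"
    unfolding *(1) by (rule span_circle_eq[OF self_in_span_circle, symmetric]) (fact *)+
  then have pv: "(p, v) \<in> span_circle p0 v0" using assms(2) by simp
  show "C = unit_circle_lift p v" using span_circle_eq[OF pv] C by simp
  show "norm p = 1" "norm v = 1" "p \<bullet> v = 0" using pv by (auto simp: span_circle_def)
qed

text \<open>The velocity is the coordinate quarter turn \<open>(- b, a)\<close> made orthogonal to
  \<open>p\<close> and normalized; subtracting a multiple of \<open>p\<close> leaves the determinant
  \<open>a\<^sup>2 + b\<^sup>2\<close> unchanged.\<close>

lemma point_in_span_circle:
  assumes indep: "\<And>c d. c *\<^sub>R X + d *\<^sub>R Y = 0 \<Longrightarrow> c = 0 \<and> d = 0"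
    and p: "p = a *\<^sub>R X + b *\<^sub>R Y" "norm p = 1"
  obtains v where "(p, v) \<in> span_circle X Y"
proof -
  define k where "k = (- b *\<^sub>R X + a *\<^sub>R Y) \<bullet> p"
  define w where "w = (- b *\<^sub>R X + a *\<^sub>R Y) - k *\<^sub>R p"
  have pp: "p \<bullet> p = 1" using p by (simp add: norm_eq_1)
  have w: "w = (- b - k * a) *\<^sub>R X + (a - k * b) *\<^sub>R Y"
    unfolding w_def by (simp add: p(1) algebra_simps)
  have det: "a * (a - k * b) - b * (- b - k * a) = a\<^sup>2 + b\<^sup>2"
    by (simp add: power2_eq_square algebra_simps)
  have "a \<noteq> 0 \<or> b \<noteq> 0" using p by auto
  then have pos: "a\<^sup>2 + b\<^sup>2 > 0" by (simp add: sum_power2_gt_zero_iff)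
  have "w \<noteq> 0"
  proof
    assume "w = 0"
    then have "- b - k * a = 0" "a - k * b = 0" using indep w by metis+
    then show False using det pos by simp
  qed
  have "p \<bullet> w = p \<bullet> (- b *\<^sub>R X + a *\<^sub>R Y) - k" unfolding w_def inner_diff_right inner_scaleR_right pp by simp
  moreover have "k = p \<bullet> (- b *\<^sub>R X + a *\<^sub>R Y)" unfolding k_def by (rule inner_commute)
  ultimately have "p \<bullet> w = 0" by simp
  have "(p, sgn w) \<in> span_circle X Y"
    unfolding span_circle_def
  proof (clarify, intro conjI exI)
    show "norm (sgn w) = 1" using \<open>w \<noteq> 0\<close> by (simp add: norm_sgn)
    show "p \<bullet> sgn w = 0" using \<open>p \<bullet> w = 0\<close> by (simp add: sgn_div_norm)
    show "sgn w = ((- b - k * a) / norm w) *\<^sub>R X + ((a - k * b) / norm w) *\<^sub>R Y"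
    proof -
      have "inverse (norm w) *\<^sub>R w = inverse (norm w) *\<^sub>R ((- b - k * a) *\<^sub>R X + (a - k * b) *\<^sub>R Y)"
        using w by (rule arg_cong)
      then show ?thesis by (simp add: sgn_div_norm scaleR_add_right divide_inverse_commute)
    qed
    have "a * (x / N) - b * (y / N) = (a * x - b * y) / N" for x y N :: real
      by (simp add: diff_divide_distrib)
    then have "a * ((a - k * b) / norm w) - b * ((- b - k * a) / norm w) = (a\<^sup>2 + b\<^sup>2) / norm w"
      unfolding det[symmetric] .
    then show "a * ((a - k * b) / norm w) - b * ((- b - k * a) / norm w) > 0"
      using pos \<open>w \<noteq> 0\<close> by simp
  qed (fact p)+
  then show thesis by (rule that)
qed

lemma unit_combination_in_circle:
  assumes "norm p = 1" "norm v = 1" "p \<bullet> v = 0" "norm (c *\<^sub>R p + s *\<^sub>R v) = 1"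
  shows "c *\<^sub>R p + s *\<^sub>R v \<in> circle_points (unit_circle_lift p v)"
proof -
  have "c\<^sup>2 + s\<^sup>2 = 1" using assms orthonormal_combination(2) by blast
  then obtain t where "c = cos t" "s = sin t" using sincos_total_2pi by metis
  then show ?thesis unfolding circle_points_def unit_circle_lift_def image_image fst_conv
    by (intro range_eqI[of _ _ t]) simp
qed

lemma circle_pointsE:
  assumes "z \<in> circle_points (unit_circle_lift p v)"
  obtains c s where "z = c *\<^sub>R p + s *\<^sub>R v"
  using assms by (auto simp: circle_points_def unit_circle_lift_def)

lemma span_circle_great:
  fixes X Y :: "(real^3) \<times> real"
  assumes indep: "\<And>c d. c *\<^sub>R X + d *\<^sub>R Y = 0 \<Longrightarrow> c = 0 \<and> d = 0"
  shows "span_circle X Y \<in> oriented_great_circles"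
proof -
  have "X \<noteq> 0" using indep[of 1 0] by auto
  then have nX: "norm (sgn X) = 1" by (simp add: norm_sgn)
  have sX: "sgn X = (1 / norm X) *\<^sub>R X + 0 *\<^sub>R Y" by (simp add: sgn_div_norm inverse_eq_divide)
  obtain v where v: "(sgn X, v) \<in> span_circle X Y"
    by (rule point_in_span_circle[OF indep sX nX])
  then have "norm (sgn X) = 1" "norm v = 1" "sgn X \<bullet> v = 0" by (auto simp: span_circle_def)
  then show ?thesis using span_circle_eq[OF v] unfolding oriented_great_circles_eq by blast
qed

text \<open>By disjointness only one circle passes through \<open>p\<close>; started at
  \<open>(p, v)\<close>, it is at \<open>p\<close> only when \<open>cos t = 1\<close>, and then its
  velocity is \<open>v\<close>.\<close>

lemma circle_velocity_eq:
  assumes F: "F \<subseteq> oriented_great_circles"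
    and disj: "\<And>C D. C \<in> F \<Longrightarrow> D \<in> F \<Longrightarrow> C \<noteq> D \<Longrightarrow> circle_points C \<inter> circle_points D = {}"
    and pv: "(p, v) \<in> \<Union>F"
  shows "circle_velocity F p = v"
  unfolding circle_velocity_def
proof (rule the_equality)
  show "\<exists>C\<in>F. (p, v) \<in> C" using pv by auto
next
  fix v' assume "\<exists>C\<in>F. (p, v') \<in> C"
  then obtain C D where CD: "C \<in> F" "(p, v') \<in> C" "D \<in> F" "(p, v) \<in> D" using pv by auto
  then have "p \<in> circle_points C \<inter> circle_points D" by (force simp: circle_points_def)
  then have "C = D" using disj CD by blast
  have D: "D = unit_circle_lift p v" "norm p = 1" "p \<bullet> v = 0"
    using great_circle_rebase[of D p v] CD F by auto
  then obtain t where t: "p = cos t *\<^sub>R p + sin t *\<^sub>R v" "v' = cos t *\<^sub>R v - sin t *\<^sub>R p"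
    using CD(2) \<open>C = D\<close> by (auto simp: unit_circle_lift_def)
  have "p \<bullet> p = cos t * (p \<bullet> p) + sin t * (v \<bullet> p)"
    using t(1) by (metis inner_add_left inner_scaleR_left)
  then have "cos t = 1" using D(2,3) by (auto simp: norm_eq_1 inner_commute[of v])
  moreover from this have "sin t = 0" using sin_cos_squared_add[of t] by simp
  ultimately show "v' = v" using t(2) by simp
qed

text \<open>The circle starts at the equatorial point \<open>(q, 0)\<close>, the point at infinity
  of the image line in direction \<open>q\<close>. If it rises there (\<open>s > 0\<close>), the
  image comes in from that end and so runs in direction \<open>- q\<close>.\<close>

lemma central_image_iff:
  fixes q v0 :: "real^3"
  assumes q: "norm q = 1" and v: "norm (v0, s) = 1" "q \<bullet> v0 = 0" and s: "s \<noteq> 0"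
  defines "C \<equiv> unit_circle_lift (q, 0) (v0, s)"
  shows "central_image C l \<longleftrightarrow> l = (range (\<lambda>t. v0 /\<^sub>R s + t *\<^sub>R q), - sgn s *\<^sub>R q)"
    and "\<not> circle_points C \<subseteq> equator"
proof -
  have points: "circle_points C = range (\<lambda>\<theta>. (cos \<theta> *\<^sub>R q + sin \<theta> *\<^sub>R v0, s * sin \<theta>))"
    unfolding C_def unit_circle_lift_def circle_points_def by (auto simp: image_image mult.commute)
  have upper: "central_projection ` {p \<in> circle_points C. snd p > 0} = range (\<lambda>t. v0 /\<^sub>R s + t *\<^sub>R q)"
  proof safe
    fix x y assume "(x, y) \<in> circle_points C" "snd (x, y) > 0"
    then obtain \<theta> where \<theta>: "x = cos \<theta> *\<^sub>R q + sin \<theta> *\<^sub>R v0" "y = s * sin \<theta>" "s * sin \<theta> > 0"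
      by (auto simp: points)
    then have "sin \<theta> \<noteq> 0" by auto
    then show "central_projection (x, y) \<in> range (\<lambda>t. v0 /\<^sub>R s + t *\<^sub>R q)"
      using s by (intro range_eqI[of _ _ "cos \<theta> / (s * sin \<theta>)"])
        (simp add: central_projection_def \<theta> scaleR_add_right field_simps)
  next
    fix t
    \<comment> \<open>The sine of the angle whose cotangent is \<open>s * t\<close>, with the sign
      that puts the point into the upper half.\<close>
    define r where "r = sgn s / sqrt (1 + (s * t)\<^sup>2)"
    have r: "r \<noteq> 0" "s * r > 0"
    proof -
      have "sqrt (1 + (s * t)\<^sup>2) > 0" by (simp add: add_pos_nonneg)
      then show "r \<noteq> 0" "s * r > 0" using s by (simp_all add: r_def sgn_if)
    qed
    have "1 + (s * t)\<^sup>2 > 0" by (simp add: add_pos_nonneg)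
    then have "r\<^sup>2 * (1 + (s * t)\<^sup>2) = 1"
      using s by (simp add: r_def power_divide sgn_if)
    then have "(r * (s * t))\<^sup>2 + r\<^sup>2 = 1" by (simp add: power_mult_distrib algebra_simps)
    then obtain \<theta> where \<theta>: "r * (s * t) = cos \<theta>" "r = sin \<theta>" using sincos_total_2pi by metis
    have "(cos \<theta> *\<^sub>R q + sin \<theta> *\<^sub>R v0, s * sin \<theta>) \<in> {p \<in> circle_points C. snd p > 0}"
      using r by (auto simp: points \<theta>)
    moreover have "v0 /\<^sub>R s + t *\<^sub>R q = central_projection (cos \<theta> *\<^sub>R q + sin \<theta> *\<^sub>R v0, s * sin \<theta>)"
      using r s by (simp add: central_projection_def scaleR_add_right field_simps flip: \<theta>)
    ultimately show "v0 /\<^sub>R s + t *\<^sub>R q \<in> central_projection ` {p \<in> circle_points C. snd p > 0}"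
      by (rule rev_image_eqI)
  qed
  \<comment> \<open>In the quotient rule the \<open>v0\<close> terms cancel; what remains is a
    multiple of \<open>q\<close> with sign opposite to \<open>s\<close>, at every point of the upper
    half.\<close>
  have deriv: "((\<lambda>t. central_projection (cos t *\<^sub>R p + sin t *\<^sub>R v)) has_vector_derivative (- s / (snd p)\<^sup>2) *\<^sub>R q) (at 0)"
    if C: "(p, v) \<in> C" and pos: "snd p > 0" for p v
  proof -
    obtain \<theta> where \<theta>: "p = (cos \<theta> *\<^sub>R q + sin \<theta> *\<^sub>R v0, s * sin \<theta>)" "v = (cos \<theta> *\<^sub>R v0 - sin \<theta> *\<^sub>R q, s * cos \<theta>)"
      using C unfolding C_def unit_circle_lift_def by (auto simp: mult.commute)
    have nz: "snd p \<noteq> 0" using pos by simp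
    have "((\<lambda>t. 1 / (cos t * snd p + sin t * snd v)) has_real_derivative - (snd v / (snd p)\<^sup>2)) (at 0)"
      by (rule derivative_eq_intros refl | simp add: nz power2_eq_square)+
    moreover have "((\<lambda>t. cos t *\<^sub>R fst p + sin t *\<^sub>R fst v) has_vector_derivative fst v) (at 0)"
      by (rule derivative_eq_intros refl | simp)+
    ultimately have "((\<lambda>t. (1 / (cos t * snd p + sin t * snd v)) *\<^sub>R (cos t *\<^sub>R fst p + sin t *\<^sub>R fst v)) has_vector_derivative
        (1 / snd p) *\<^sub>R fst v - (snd v / (snd p)\<^sup>2) *\<^sub>R fst p) (at 0)"
      by (rule has_vector_derivative_eq_rhs[OF has_vector_derivative_scaleR]) simp
    moreover have "(1 / snd p) *\<^sub>R fst v - (snd v / (snd p)\<^sup>2) *\<^sub>R fst p = (- s / (snd p)\<^sup>2) *\<^sub>R q"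
    proof -
      have "(snd p)\<^sup>2 *\<^sub>R ((1 / snd p) *\<^sub>R fst v - (snd v / (snd p)\<^sup>2) *\<^sub>R fst p) = snd p *\<^sub>R fst v - snd v *\<^sub>R fst p"
        using nz by (simp add: scaleR_diff_right power2_eq_square)
      also have "\<dots> = - (s * ((sin \<theta>)\<^sup>2 + (cos \<theta>)\<^sup>2)) *\<^sub>R q"
      proof -
        have "(s * y) *\<^sub>R (x *\<^sub>R v0 - y *\<^sub>R q) - (s * x) *\<^sub>R (x *\<^sub>R q + y *\<^sub>R v0) = - (s * (y\<^sup>2 + x\<^sup>2)) *\<^sub>R q" for x y
          by (simp add: power2_eq_square algebra_simps)
        then show ?thesis by (simp only: \<theta> fst_conv snd_conv)
      qed
      also have "\<dots> = (snd p)\<^sup>2 *\<^sub>R ((- s / (snd p)\<^sup>2) *\<^sub>R q)" using nz by simp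
      finally show ?thesis by (rule scaleR_left_imp_eq[rotated]) (simp add: nz)
    qed
    ultimately show ?thesis
      by (simp add: central_projection_def divide_inverse)
  qed
  \<comment> \<open>The quarter turn reaching the highest point of the circle, where the last
    coordinate is \<open>\<bar>s\<bar>\<close>; it provides a point in the upper half.\<close>
  define \<theta>0 where "\<theta>0 = sgn s * (pi / 2)"
  have sin0: "sin \<theta>0 = sgn s" using s by (simp add: \<theta>0_def sgn_if)
  obtain p0 u0 where p0: "(p0, u0) \<in> C" "snd p0 > 0"
  proof
    show "(cos \<theta>0 *\<^sub>R (q, 0) + sin \<theta>0 *\<^sub>R (v0, s), cos \<theta>0 *\<^sub>R (v0, s) - sin \<theta>0 *\<^sub>R (q, 0)) \<in> C"
      by (auto simp: C_def unit_circle_lift_def)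
    show "snd (cos \<theta>0 *\<^sub>R (q, 0) + sin \<theta>0 *\<^sub>R (v0, s)) > 0" using s by (simp add: sin0 sgn_if)
  qed
  then have "p0 \<in> circle_points C" by (force simp: circle_points_def)
  then show "\<not> circle_points C \<subseteq> equator" using p0 by (auto simp: equator_def)
  show "central_image C l \<longleftrightarrow> l = (range (\<lambda>t. v0 /\<^sub>R s + t *\<^sub>R q), - sgn s *\<^sub>R q)"
  proof
    assume l: "central_image C l"
    then have "norm (snd l) = 1" by (simp add: central_image_def)
    obtain c where c: "c > 0" "((\<lambda>t. central_projection (cos t *\<^sub>R p0 + sin t *\<^sub>R u0)) has_vector_derivative c *\<^sub>R snd l) (at 0)"
      using l p0 by (auto simp: central_image_def)
    then have eq: "c *\<^sub>R snd l = (- s / (snd p0)\<^sup>2) *\<^sub>R q"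
      using vector_derivative_unique_at deriv[OF p0] by blast
    have "sgn (c *\<^sub>R snd l) = snd l" using c \<open>norm (snd l) = 1\<close> by (simp add: sgn_div_norm)
    moreover have "sgn ((- s / (snd p0)\<^sup>2) *\<^sub>R q) = - sgn s *\<^sub>R q"
    proof -
      have "sgn (- s / (snd p0)\<^sup>2) = - sgn s" using p0 by (simp add: sgn_if divide_less_0_iff zero_less_divide_iff)
      moreover have "sgn q = q" using q by (simp add: sgn_div_norm)
      ultimately show ?thesis by (simp only: sgn_scaleR)
    qed
    ultimately have "snd l = - sgn s *\<^sub>R q" using eq by simp
    moreover have "fst l = range (\<lambda>t. v0 /\<^sub>R s + t *\<^sub>R q)" using l upper by (simp add: central_image_def)
    ultimately show "l = (range (\<lambda>t. v0 /\<^sub>R s + t *\<^sub>R q), - sgn s *\<^sub>R q)" by (simp add: prod_eq_iff)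
  next
    assume l: "l = (range (\<lambda>t. v0 /\<^sub>R s + t *\<^sub>R q), - sgn s *\<^sub>R q)"
    have "\<exists>c>0. ((\<lambda>t. central_projection (cos t *\<^sub>R p + sin t *\<^sub>R v)) has_vector_derivative c *\<^sub>R snd l) (at 0)"
      if "(p, v) \<in> C" "snd p > 0" for p v
    proof (intro exI conjI)
      show "\<bar>s\<bar> / (snd p)\<^sup>2 > 0" using s that by simp
      have "(\<bar>s\<bar> / (snd p)\<^sup>2) *\<^sub>R snd l = (- s / (snd p)\<^sup>2) *\<^sub>R q" using s by (simp add: l sgn_if)
      then show "((\<lambda>t. central_projection (cos t *\<^sub>R p + sin t *\<^sub>R v)) has_vector_derivative (\<bar>s\<bar> / (snd p)\<^sup>2) *\<^sub>R snd l) (at 0)"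
        using deriv[OF that] by simp
    qed
    moreover have "norm (snd l) = 1" using q s by (simp add: l sgn_if)
    ultimately show "central_image C l" using upper by (auto simp: central_image_def l)
  qed
qed

section \<open>Great circles over the graphs, and the horizon\<close>

definition det2 :: "real^2 \<Rightarrow> real^2 \<Rightarrow> real" where
  "det2 u w = u $ 1 * w $ 2 - u $ 2 * w $ 1"

lemma det2_combination: "det2 (a *\<^sub>R u + b *\<^sub>R w) (c *\<^sub>R u + d *\<^sub>R w) = (a * d - b * c) * det2 u w"
  by (simp add: det2_def algebra_simps)

lemma det2_orthonormal:
  assumes "norm u = 1" "norm w = 1" "u \<bullet> w = 0"
  shows "det2 u w \<noteq> 0"
proof -
  have "(det2 u w)\<^sup>2 = (u \<bullet> u) * (w \<bullet> w) - (u \<bullet> w)\<^sup>2"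
    by (simp add: det2_def inner_vec_def sum_2 power2_eq_square algebra_simps)
  then show ?thesis using assms by (auto simp: norm_eq_1)
qed

lemma orthonormal_not_proportional:
  fixes p v :: "'a::real_inner"
  assumes "norm p = 1" "norm v = 1" "p \<bullet> v = 0" "c *\<^sub>R p = d *\<^sub>R v"
  shows "c = 0" "d = 0"
proof -
  have "(c *\<^sub>R p) \<bullet> p = (d *\<^sub>R v) \<bullet> p" using assms(4) by simp
  then show "c = 0" using assms(1-3) by (auto simp: norm_eq_1 inner_commute[of v p])
  then show "d = 0" using assms(2,4) by auto
qed

context skew_graph_family
begin

text \<open>A point of \<open>\<real>\<^sup>4\<close> equals \<open>c\<close> times the lifted base point plus \<open>b\<close> times the lifted direction of the fiber
  over \<open>y\<close> iff its last coordinate is \<open>c\<close>, its \<open>level\<close> is \<open>b\<close> and its \<open>shadow\<close> is \<open>c y + b B(y)\<close>.\<close>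

definition level :: "(real^3) \<times> real \<Rightarrow> real" where
  "level p = snd (coord (fst p - snd p *\<^sub>R a))"

definition shadow :: "(real^3) \<times> real \<Rightarrow> real^2" where
  "shadow p = fst (coord (fst p - snd p *\<^sub>R a))"

definition assemble :: "real^2 \<Rightarrow> real \<Rightarrow> real \<Rightarrow> (real^3) \<times> real" where
  "assemble w b c = (c *\<^sub>R a + lin (w, b), c)"

lemma assemble_simps [simp]:
  "snd (assemble w b c) = c" "level (assemble w b c) = b" "shadow (assemble w b c) = w"
  by (simp_all add: assemble_def level_def shadow_def)

lemma assemble_parts: "assemble (shadow p) (level p) (snd p) = p"
  by (simp add: assemble_def shadow_def level_def prod_eq_iff)

lemma assemble_0 [simp]: "assemble 0 0 0 = 0"
  by (simp add: assemble_def lin_simps zero_prod_def[symmetric])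

lemma tendsto_level [tendsto_intros]: "(f \<longlongrightarrow> p) F \<Longrightarrow> ((\<lambda>x. level (f x)) \<longlongrightarrow> level p) F"
proof (rule continuous_on_tendsto_compose[of UNIV level])
  show "continuous_on UNIV level" unfolding level_def by (intro continuous_intros)
qed simp_all

lemma tendsto_shadow [tendsto_intros]: "(f \<longlongrightarrow> p) F \<Longrightarrow> ((\<lambda>x. shadow (f x)) \<longlongrightarrow> shadow p) F"
proof (rule continuous_on_tendsto_compose[of UNIV shadow])
  show "continuous_on UNIV shadow" unfolding shadow_def by (intro continuous_intros)
qed simp_all

lemma tendsto_B: "(f \<longlongrightarrow> y) F \<Longrightarrow> ((\<lambda>x. B (f x)) \<longlongrightarrow> B y) F"
  by (rule continuous_on_tendsto_compose[OF continuous_B]) simp_all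

text \<open>The plane of \<real>^4 over the graph, spanned by its lifted base point and its point at
  infinity. Turning from the former to the latter matches increasing \<open>t\<close>.\<close>

definition fiber_circle :: "real^2 \<Rightarrow> oriented_circle" where
  "fiber_circle y = span_circle (Phi (y, 0), 1) (lin (B y, 1), 0)"

text \<open>The great circle at infinity of the base plane; \<open>e\<close> is 1 or -1 and selects
  its orientation.\<close>

definition horizon :: "real \<Rightarrow> oriented_circle" where
  "horizon e = span_circle (e1, 0) (e *\<^sub>R e2, 0)"

lemma fiber_combination:
  "c *\<^sub>R (Phi (y, 0), 1) + d *\<^sub>R (lin (B y, 1), 0) = assemble (c *\<^sub>R y + d *\<^sub>R B y) d c"
  by (simp add: assemble_def Phi_def scaleR_add_right lin_simps(1,3)[symmetric])

lemma horizon_combination: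
  "c *\<^sub>R (e1, 0) + d *\<^sub>R (e *\<^sub>R e2, 0) = assemble (vector [c, e * d]) 0 0"
  by (simp add: assemble_def lin_def mult.commute)

lemma fiber_independent:
  assumes "c *\<^sub>R (Phi (y, 0), 1 :: real) + d *\<^sub>R (lin (B y, 1), 0) = 0"
  shows "c = 0 \<and> d = 0"
proof -
  have "assemble (c *\<^sub>R y + d *\<^sub>R B y) d c = assemble 0 0 0" using assms fiber_combination by simp
  then show ?thesis by (metis assemble_simps(1,2))
qed

lemma horizon_independent:
  assumes e: "e = 1 \<or> e = -1" and eq: "c *\<^sub>R (e1, 0 :: real) + d *\<^sub>R (e *\<^sub>R e2, 0) = 0"
  shows "c = 0 \<and> d = 0"
proof -
  have "shadow (assemble (vector [c, e * d]) 0 0) = shadow (assemble 0 0 0)"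
    using eq unfolding horizon_combination by simp
  then have "vector [c, e * d] = (0 :: real^2)" by (simp only: assemble_simps)
  then have "c = 0" "e * d = 0" by (metis vector_2 zero_index)+
  then show ?thesis using e by auto
qed

lemma mem_fiber_circle_iff:
  "(p, v) \<in> fiber_circle y \<longleftrightarrow> norm p = 1 \<and> norm v = 1 \<and> p \<bullet> v = 0 \<and>
     shadow p = snd p *\<^sub>R y + level p *\<^sub>R B y \<and> shadow v = snd v *\<^sub>R y + level v *\<^sub>R B y \<and>
     snd p * level v - level p * snd v > 0"
proof -
  have iff: "p = assemble (c *\<^sub>R y + d *\<^sub>R B y) d c \<longleftrightarrow> c = snd p \<and> d = level p \<and> shadow p = snd p *\<^sub>R y + level p *\<^sub>R B y" for p c d
    by (metis assemble_parts assemble_simps)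
  show ?thesis unfolding fiber_circle_def span_circle_def fiber_combination iff by auto
qed

lemma mem_horizon_iff:
  assumes e: "e = 1 \<or> e = -1"
  shows "(p, v) \<in> horizon e \<longleftrightarrow> norm p = 1 \<and> norm v = 1 \<and> p \<bullet> v = 0 \<and>
     snd p = 0 \<and> level p = 0 \<and> snd v = 0 \<and> level v = 0 \<and> e * det2 (shadow p) (shadow v) > 0"
proof -
  have ee: "e * e = 1" using e by auto
  have iff: "p = assemble (vector [c, e * d]) 0 0 \<longleftrightarrow> c = shadow p $ 1 \<and> d = e * shadow p $ 2 \<and> snd p = 0 \<and> level p = 0" for p c d
  proof
    assume "p = assemble (vector [c, e * d]) 0 0"
    then show "c = shadow p $ 1 \<and> d = e * shadow p $ 2 \<and> snd p = 0 \<and> level p = 0"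
      using ee by (simp add: mult.assoc[symmetric])
  next
    assume *: "c = shadow p $ 1 \<and> d = e * shadow p $ 2 \<and> snd p = 0 \<and> level p = 0"
    then have "vector [c, e * d] = shadow p"
      using ee by (simp add: vec_eq_iff forall_2 mult.assoc[symmetric])
    then show "p = assemble (vector [c, e * d]) 0 0" using * assemble_parts[of p] by simp
  qed
  have "shadow p $ 1 * (e * shadow v $ 2) - e * shadow p $ 2 * shadow v $ 1 = e * det2 (shadow p) (shadow v)"
    by (simp add: det2_def algebra_simps)
  then show ?thesis unfolding horizon_def span_circle_def horizon_combination iff by auto
qed

lemma fiber_circle_great: "fiber_circle y \<in> oriented_great_circles"
  unfolding fiber_circle_def by (rule span_circle_great) (rule fiber_independent)

lemma horizon_great:
  assumes "e = 1 \<or> e = -1"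
  shows "horizon e \<in> oriented_great_circles"
  unfolding horizon_def by (rule span_circle_great) (rule horizon_independent[OF assms])

lemma fiber_circle_points_iff:
  "p \<in> circle_points (fiber_circle y) \<longleftrightarrow> norm p = 1 \<and> shadow p = snd p *\<^sub>R y + level p *\<^sub>R B y"
proof
  assume *: "norm p = 1 \<and> shadow p = snd p *\<^sub>R y + level p *\<^sub>R B y"
  then have pe: "p = snd p *\<^sub>R (Phi (y, 0), 1) + level p *\<^sub>R (lin (B y, 1), 0)"
    unfolding fiber_combination by (metis assemble_parts)
  have pn: "norm p = 1" using * by simp
  obtain v where "(p, v) \<in> fiber_circle y"
    unfolding fiber_circle_def by (rule point_in_span_circle[OF fiber_independent pe pn])
  then show "p \<in> circle_points (fiber_circle y)" by (force simp: circle_points_def)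
qed (auto simp: circle_points_def mem_fiber_circle_iff)

lemma horizon_points_iff:
  assumes e: "e = 1 \<or> e = -1"
  shows "p \<in> circle_points (horizon e) \<longleftrightarrow> norm p = 1 \<and> snd p = 0 \<and> level p = 0"
proof
  assume *: "norm p = 1 \<and> snd p = 0 \<and> level p = 0"
  have "vector [shadow p $ 1, e * (e * shadow p $ 2)] = shadow p"
    using e by (auto simp: vec_eq_iff forall_2)
  then have pe: "p = shadow p $ 1 *\<^sub>R (e1, 0) + (e * shadow p $ 2) *\<^sub>R (e *\<^sub>R e2, 0)"
    unfolding horizon_combination using * by (metis assemble_parts)
  have pn: "norm p = 1" using * by simp
  obtain v where "(p, v) \<in> horizon e"
    unfolding horizon_def by (rule point_in_span_circle[OF horizon_independent[OF e] pe pn])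
  then show "p \<in> circle_points (horizon e)" by (force simp: circle_points_def)
qed (auto simp: circle_points_def mem_horizon_iff[OF e])

text \<open>A common point of two fiber circles gives a relation in \<open>kernel\<close> with
  coefficients \<open>level p\<close> and \<open>snd p\<close>. Both vanish, as they do on the
  horizon; then the shadow vanishes too, and \<open>p = 0\<close>.\<close>

lemma circles_disjoint:
  "y \<noteq> z \<Longrightarrow> circle_points (fiber_circle y) \<inter> circle_points (fiber_circle z) = {}"
  "e = 1 \<or> e = -1 \<Longrightarrow> circle_points (fiber_circle y) \<inter> circle_points (horizon e) = {}"
proof -
  have zero: False if "norm p = 1" "shadow p = 0" "level p = 0" "snd p = 0" for p
    using that assemble_parts[of p] by simp
  show "circle_points (fiber_circle y) \<inter> circle_points (fiber_circle z) = {}" if "y \<noteq> z"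
  proof safe
    fix p assume p: "p \<in> circle_points (fiber_circle y)" "p \<in> circle_points (fiber_circle z)"
    then have "level p *\<^sub>R (B y - B z) + snd p *\<^sub>R (y - z) = 0"
      unfolding fiber_circle_points_iff by (simp add: algebra_simps)
    then have "level p = 0 \<and> snd p = 0" using kernel that by blast
    then show "p \<in> {}" using zero[of p] p unfolding fiber_circle_points_iff by simp
  qed
  show "circle_points (fiber_circle y) \<inter> circle_points (horizon e) = {}" if "e = 1 \<or> e = -1"
    using zero by (auto simp: fiber_circle_points_iff horizon_points_iff[OF that])
qed

lemma central_image_fiber_circle:
  "central_image (fiber_circle y) l \<longleftrightarrow> l = graph_line Phi B y"
  "\<not> circle_points (fiber_circle y) \<subseteq> equator"
proof -
  define N where "N = norm (lin (B y, 1))"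
  have N: "N > 0" using lin_nonzero by (simp add: N_def zero_prod_def)
  define u where "u = sgn (lin (B y, 1))"
  have u: "norm u = 1" "lin (B y, 1) = N *\<^sub>R u"
    using N by (simp_all add: u_def norm_sgn sgn_div_norm N_def zero_prod_def)
  have ue: "(u, 0 :: real) = 0 *\<^sub>R (Phi (y, 0), 1) + (1 / N) *\<^sub>R (lin (B y, 1), 0)"
    using N by (simp add: u)
  have un: "norm (u, 0 :: real) = 1" using u by (simp add: norm_Pair)
  obtain v' where "((u, 0), v') \<in> fiber_circle y"
    unfolding fiber_circle_def by (rule point_in_span_circle[OF fiber_independent ue un])
  then obtain v0 s where v: "((u, 0), (v0, s)) \<in> fiber_circle y" by (metis surj_pair)
  have C: "fiber_circle y = unit_circle_lift (u, 0) (v0, s)"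
    using v unfolding fiber_circle_def by (rule span_circle_eq)
  have "level (u, 0) = 1 / N"
  proof -
    have "lin ((1 / N) *\<^sub>R (B y, 1)) = u" unfolding lin_simps(3) u(2) using N by simp
    then have "coord u = (1 / N) *\<^sub>R (B y, 1)" by (metis coord_lin)
    then show ?thesis by (simp add: level_def)
  qed
  \<comment> \<open>At \<open>(u, 0)\<close> the last coordinate is 0 and the level is positive, so
    the orientation condition of the circle forces it downwards; its image therefore runs along
    \<open>u\<close>.\<close>
  then have s: "s < 0" using v N by (auto simp: mem_fiber_circle_iff divide_less_0_iff)
  have orth: "norm (v0, s) = 1" "u \<bullet> v0 = 0" using v by (simp_all add: mem_fiber_circle_iff)
  define b where "b = level (v0, s)"
  have "(v0, s) = assemble (s *\<^sub>R y + b *\<^sub>R B y) b s"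
    using v assemble_parts[of "(v0, s)"] by (simp add: mem_fiber_circle_iff b_def)
  then have "(v0, s) = s *\<^sub>R (Phi (y, 0), 1) + b *\<^sub>R (lin (B y, 1), 0)"
    unfolding fiber_combination .
  then have "v0 = s *\<^sub>R Phi (y, 0) + (b * N) *\<^sub>R u" by (simp add: u)
  then have "v0 /\<^sub>R s = Phi (y, 0) + (b * N / s) *\<^sub>R u"
    using s by (simp add: scaleR_add_right divide_inverse_commute mult.commute)
  then have "range (\<lambda>t. v0 /\<^sub>R s + t *\<^sub>R u) = range (\<lambda>t. Phi (y, 0) + t *\<^sub>R u)"
    by (simp add: range_line_shift)
  then have "graph_line Phi B y = (range (\<lambda>t. v0 /\<^sub>R s + t *\<^sub>R u), - sgn s *\<^sub>R u)"
    using s by (simp add: graph_line_eq u_def)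
  then show "central_image (fiber_circle y) l \<longleftrightarrow> l = graph_line Phi B y"
    "\<not> circle_points (fiber_circle y) \<subseteq> equator"
    using central_image_iff[OF u(1) orth] s unfolding C by simp_all
qed

lemma horizon_in_equator:
  assumes "e = 1 \<or> e = -1"
  shows "circle_points (horizon e) \<subseteq> equator"
  using horizon_points_iff[OF assms] by (auto simp: equator_def)

text \<open>Since \<open>B 0 = 0\<close>, property (1) for \<open>y\<close> and 0 makes
  \<open>y\<close> and \<open>B y\<close> independent when \<open>y \<noteq> 0\<close>, and the
  punctured plane is connected.\<close>

lemma det2_B_constant_sign:
  assumes "B 0 = 0"
  obtains e :: real where "e = 1 \<or> e = -1" "\<And>y. e * det2 y (B y) \<ge> 0"
proof -
  have nonzero: "det2 y (B y) \<noteq> 0" if "y \<noteq> 0" for y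
  proof
    assume "det2 y (B y) = 0"
    \<comment> \<open>For dependent vectors \<open>B y\<close> is its own projection onto
      \<open>y\<close>; clearing the denominator gives this relation.\<close>
    then have "(y \<bullet> y) *\<^sub>R (B y - B 0) + (- (B y \<bullet> y)) *\<^sub>R (y - 0) = 0"
      using assms by (auto simp: vec_eq_iff forall_2 det2_def inner_vec_def sum_2) algebra+
    then have "y \<bullet> y = 0" using kernel that by blast
    then show False using that by simp
  qed
  have conn: "connected ((\<lambda>y. det2 y (B y)) ` (- {0}))"
    unfolding det2_def
    by (intro connected_continuous_image connected_punctured_universe continuous_intros
        continuous_on_subset[OF continuous_B]) auto
  have no: "0 \<notin> (\<lambda>y. det2 y (B y)) ` (- {0})"
  proof
    assume "0 \<in> (\<lambda>y. det2 y (B y)) ` (- {0})"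
    then obtain y where y: "0 = det2 y (B y)" "y \<in> - {0}" by (rule imageE)
    show False using nonzero[of y] y by simp
  qed
  have same: "\<not> (det2 y (B y) < 0 \<and> det2 z (B z) > 0)" if yz: "y \<noteq> 0" "z \<noteq> 0" for y z
  proof
    assume sgn: "det2 y (B y) < 0 \<and> det2 z (B z) > 0"
    have "{det2 y (B y)..det2 z (B z)} \<subseteq> (\<lambda>y. det2 y (B y)) ` (- {0})"
      using yz by (intro connected_contains_Icc[OF conn] imageI) simp_all
    moreover have "0 \<in> {det2 y (B y)..det2 z (B z)}" using sgn by simp
    ultimately show False using no by blast
  qed
  have zero: "det2 0 (B 0) = 0" by (simp add: det2_def)
  show thesis
  proof (cases "\<exists>y. det2 y (B y) < 0")
    case True
    then obtain y where y: "det2 y (B y) < 0" by blast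
    then have "y \<noteq> 0" using zero by auto
    then have "det2 z (B z) \<le> 0" for z using same[of y z] y zero by (cases "z = 0") auto
    then show ?thesis using that[of "-1"] by auto
  next
    case False
    then show ?thesis using that[of 1] by (auto simp: not_less)
  qed
qed

section \<open>The second chart and limits of fiber circles\<close>

definition coflow :: "(real^2) \<times> real \<Rightarrow> (real^2) \<times> real" where
  "coflow p = (B (fst p) + snd p *\<^sub>R fst p, snd p)"

lemma continuous_coflow: "continuous_on UNIV coflow"
  unfolding coflow_def
  by (intro continuous_intros continuous_on_compose2[OF continuous_B]) auto

text \<open>The layer \<open>s = 0\<close> is \<open>B\<close> itself, so surjectivity of
  \<open>B\<close> enters there; for \<open>s \<noteq> 0\<close> the map is \<open>flow\<close> at
  height \<open>1 / s\<close>, rescaled.\<close>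

lemma bij_coflow:
  assumes "surj B"
  shows "bij coflow"
proof (rule bijI)
  show "inj coflow"
  proof (rule injI)
    fix p q assume *: "coflow p = coflow q"
    then have snd: "snd p = snd q" by (simp add: coflow_def)
    have "B (fst p) + snd p *\<^sub>R fst p = B (fst q) + snd p *\<^sub>R fst q"
      using * by (simp add: coflow_def snd)
    then have "1 *\<^sub>R (B (fst p) - B (fst q)) + snd p *\<^sub>R (fst p - fst q) = 0"
      by (simp add: algebra_simps)
    then have "fst p = fst q" using kernel one_neq_zero by blast
    then show "p = q" using snd by (simp add: prod_eq_iff)
  qed
  have "\<exists>p. coflow p = x" for x
  proof (cases "snd x = 0")
    case True
    obtain y where "fst x = B y" using assms by blast
    then have "coflow (y, 0) = x" using True by (simp add: coflow_def prod_eq_iff)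
    then show ?thesis ..
  next
    case False
    define s where "s = snd x"
    obtain p where p: "flow p = ((1 / s) *\<^sub>R fst x, 1 / s)" using bij_flow by (metis bij_pointE)
    have "snd p = 1 / s" "snd p *\<^sub>R B (fst p) + fst p = (1 / s) *\<^sub>R fst x"
      using arg_cong[OF p, of snd] arg_cong[OF p, of fst] by (simp_all add: flow_def)
    then have "(1 / s) *\<^sub>R fst x = (1 / s) *\<^sub>R B (fst p) + fst p" by metis
    then have "s *\<^sub>R ((1 / s) *\<^sub>R fst x) = s *\<^sub>R ((1 / s) *\<^sub>R B (fst p) + fst p)" by simp
    then have "coflow (fst p, s) = x" using False by (simp add: coflow_def s_def prod_eq_iff scaleR_add_right)
    then show ?thesis ..
  qed
  then show "surj coflow" by (metis surj_def)
qed

text \<open>If points converge to a limit off the horizon, the fibers through them converge: \<open>flow\<close> and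
  \<open>coflow\<close> are the two affine charts in which the fiber is read off continuously.\<close>

lemma feet_converge:
  assumes surj: "surj B" and q: "q \<longlonglongrightarrow> l" and nz: "snd l \<noteq> 0 \<or> level l \<noteq> 0"
    and ev: "eventually (\<lambda>k. shadow (q k) = snd (q k) *\<^sub>R y k + level (q k) *\<^sub>R B (y k)) sequentially"
  shows "\<exists>y0. y \<longlonglongrightarrow> y0"
  using nz
proof
  assume nz: "snd l \<noteq> 0"
  have lim: "(\<lambda>k. snd (q k)) \<longlonglongrightarrow> snd l" by (intro tendsto_intros q)
  define f where "f k = inv flow ((1 / snd (q k)) *\<^sub>R shadow (q k), level (q k) / snd (q k))" for k
  have "f \<longlonglongrightarrow> inv flow ((1 / snd l) *\<^sub>R shadow l, level l / snd l)"
    unfolding f_def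
    by (intro continuous_on_tendsto_compose[OF continuous_bijection_inverse[OF continuous_flow bij_flow]] tendsto_intros q nz) auto
  then have "(\<lambda>k. fst (f k)) \<longlonglongrightarrow> fst (inv flow ((1 / snd l) *\<^sub>R shadow l, level l / snd l))"
    by (rule tendsto_fst)
  moreover have "eventually (\<lambda>k. fst (f k) = y k) sequentially"
    using ev tendsto_imp_eventually_ne[OF lim nz]
  proof eventually_elim
    case (elim k)
    have "flow (y k, level (q k) / snd (q k)) = ((1 / snd (q k)) *\<^sub>R shadow (q k), level (q k) / snd (q k))"
      using elim by (simp add: flow_def scaleR_add_right)
    then have "f k = (y k, level (q k) / snd (q k))"
      unfolding f_def by (metis bij_flow bij_is_inj inv_f_f)
    then show ?case by simp
  qed
  ultimately show ?thesis using Lim_transform_eventually by blast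
next
  assume nz: "level l \<noteq> 0"
  have lim: "(\<lambda>k. level (q k)) \<longlonglongrightarrow> level l" by (intro tendsto_intros q)
  define f where "f k = inv coflow ((1 / level (q k)) *\<^sub>R shadow (q k), snd (q k) / level (q k))" for k
  have "f \<longlonglongrightarrow> inv coflow ((1 / level l) *\<^sub>R shadow l, snd l / level l)"
    unfolding f_def
    by (intro continuous_on_tendsto_compose[OF continuous_bijection_inverse[OF continuous_coflow bij_coflow[OF surj]]] tendsto_intros q nz) auto
  then have "(\<lambda>k. fst (f k)) \<longlonglongrightarrow> fst (inv coflow ((1 / level l) *\<^sub>R shadow l, snd l / level l))"
    by (rule tendsto_fst)
  moreover have "eventually (\<lambda>k. fst (f k) = y k) sequentially"
    using ev tendsto_imp_eventually_ne[OF lim nz]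
  proof eventually_elim
    case (elim k)
    have "coflow (y k, snd (q k) / level (q k)) = ((1 / level (q k)) *\<^sub>R shadow (q k), snd (q k) / level (q k))"
      using elim by (simp add: coflow_def scaleR_add_right)
    then have "f k = (y k, snd (q k) / level (q k))"
      unfolding f_def by (metis bij_coflow[OF surj] bij_is_inj inv_f_f)
    then show ?case by simp
  qed
  ultimately show ?thesis using Lim_transform_eventually by blast
qed

text \<open>The linear equations pass to the limit. The strict orientation inequality survives only
  as \<open>\<ge>\<close>, and equality would make the orthonormal vectors \<open>p0\<close> and
  \<open>v0\<close> dependent.\<close>

lemma limit_in_fiber_circle:
  assumes p: "p \<longlonglongrightarrow> p0" and v: "v \<longlonglongrightarrow> v0" and y: "y \<longlonglongrightarrow> y0"
    and ev: "eventually (\<lambda>k. (p k, v k) \<in> fiber_circle (y k)) sequentially"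
    and orth: "norm p0 = 1" "norm v0 = 1" "p0 \<bullet> v0 = 0"
  shows "(p0, v0) \<in> fiber_circle y0"
proof -
  have tr: "shadow q0 = snd q0 *\<^sub>R y0 + level q0 *\<^sub>R B y0"
    if q: "q \<longlonglongrightarrow> q0" and evq: "eventually (\<lambda>k. shadow (q k) = snd (q k) *\<^sub>R y k + level (q k) *\<^sub>R B (y k)) sequentially" for q q0
  proof (rule LIMSEQ_unique)
    show "(\<lambda>k. shadow (q k)) \<longlonglongrightarrow> shadow q0" by (intro tendsto_intros q)
    have "(\<lambda>k. snd (q k) *\<^sub>R y k + level (q k) *\<^sub>R B (y k)) \<longlonglongrightarrow> snd q0 *\<^sub>R y0 + level q0 *\<^sub>R B y0"
      by (intro tendsto_intros tendsto_B q y)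
    then show "(\<lambda>k. shadow (q k)) \<longlonglongrightarrow> snd q0 *\<^sub>R y0 + level q0 *\<^sub>R B y0"
      by (rule Lim_transform_eventually) (use evq in \<open>simp add: eq_commute\<close>)
  qed
  have tp: "shadow p0 = snd p0 *\<^sub>R y0 + level p0 *\<^sub>R B y0" and tv: "shadow v0 = snd v0 *\<^sub>R y0 + level v0 *\<^sub>R B y0"
    by (rule tr[OF p], rule eventually_mono[OF ev], simp add: mem_fiber_circle_iff)
      (rule tr[OF v], rule eventually_mono[OF ev], simp add: mem_fiber_circle_iff)
  have "(\<lambda>k. snd (p k) * level (v k) - level (p k) * snd (v k)) \<longlonglongrightarrow> snd p0 * level v0 - level p0 * snd v0"
    by (intro tendsto_intros p v)
  then have "snd p0 * level v0 - level p0 * snd v0 \<ge> 0"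
    by (rule tendsto_lowerbound) (rule eventually_mono[OF ev], simp_all add: mem_fiber_circle_iff)
  moreover have "snd p0 * level v0 - level p0 * snd v0 \<noteq> 0"
  proof
    assume det: "snd p0 * level v0 - level p0 * snd v0 = 0"
    define X Y where "X = (Phi (y0, 0), 1::real)" and "Y = (lin (B y0, 1), 0::real)"
    have pX: "p0 = snd p0 *\<^sub>R X + level p0 *\<^sub>R Y" and vX: "v0 = snd v0 *\<^sub>R X + level v0 *\<^sub>R Y"
      unfolding X_def Y_def fiber_combination using tp tv by (metis assemble_parts)+
    \<comment> \<open>Eliminating either basis vector: a vanishing determinant makes
      \<open>p0\<close> and \<open>v0\<close> proportional in two ways, so both coordinates of
      \<open>p0\<close> are 0.\<close>
    have "c' *\<^sub>R (c *\<^sub>R X + d *\<^sub>R Y) - c *\<^sub>R (c' *\<^sub>R X + d' *\<^sub>R Y) = - (c * d' - d * c') *\<^sub>R Y"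
      "d' *\<^sub>R (c *\<^sub>R X + d *\<^sub>R Y) - d *\<^sub>R (c' *\<^sub>R X + d' *\<^sub>R Y) = (c * d' - d * c') *\<^sub>R X" for c d c' d'
      by (simp_all add: algebra_simps)
    from this[where c = "snd p0" and d = "level p0" and c' = "snd v0" and d' = "level v0"]
    have 1: "snd v0 *\<^sub>R p0 = snd p0 *\<^sub>R v0" and 2: "level v0 *\<^sub>R p0 = level p0 *\<^sub>R v0"
      unfolding pX[symmetric] vX[symmetric] det by simp_all
    have "snd p0 = 0" "level p0 = 0"
      using orthonormal_not_proportional[OF orth 1] orthonormal_not_proportional[OF orth 2] by auto
    then have "p0 = 0" using pX by simp
    then show False using orth by simp
  qed
  ultimately show ?thesis using orth tp tv by (simp add: mem_fiber_circle_iff)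
qed

end

section \<open>The correspondence with great circle fibrations\<close>

context skew_graph_family
begin

text \<open>A limit pair either lies entirely in the plane of the horizon, where only the
  orientation must be checked, or has a component off it, and then the feet of the approximating
  fibers converge.\<close>

lemma closed_union_of_circles:
  assumes surj: "surj B" and e: "e = 1 \<or> e = -1" and sign: "\<And>y. e * det2 y (B y) \<ge> 0"
  shows "closed (\<Union>(insert (horizon e) (range fiber_circle)))"
  unfolding closed_sequential_limits
proof (intro allI impI, elim conjE)
  fix x l assume x: "\<forall>k. x k \<in> \<Union>(insert (horizon e) (range fiber_circle))" and lim: "x \<longlonglongrightarrow> l"
  define p v where "p = (\<lambda>k. fst (x k))" and "v = (\<lambda>k. snd (x k))"
  obtain p0 v0 where l: "l = (p0, v0)" by (rule prod.exhaust)
  have p: "p \<longlonglongrightarrow> p0" and v: "v \<longlonglongrightarrow> v0"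
    using tendsto_fst[OF lim] tendsto_snd[OF lim] by (simp_all add: p_def v_def l)
  have mem: "(p k, v k) \<in> horizon e \<or> (\<exists>y. (p k, v k) \<in> fiber_circle y)" for k
    using x[rule_format, of k] by (auto simp: p_def v_def)
  have unit: "norm (p k) = 1" "norm (v k) = 1" "p k \<bullet> v k = 0" for k
    using mem[of k] by (auto simp: mem_horizon_iff[OF e] mem_fiber_circle_iff)
  have orth: "norm p0 = 1" "norm v0 = 1" "p0 \<bullet> v0 = 0"
    using tendsto_norm[OF p] tendsto_norm[OF v] tendsto_inner[OF p v]
    by (simp_all add: unit LIMSEQ_const_iff)
  show "l \<in> \<Union>(insert (horizon e) (range fiber_circle))"
  proof (cases "snd p0 = 0 \<and> level p0 = 0 \<and> snd v0 = 0 \<and> level v0 = 0")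
    case True
    \<comment> \<open>On a fiber circle this determinant is a positive factor times
      \<open>e * det2 y (B y)\<close>, which is nonnegative by the choice of
      \<open>e\<close>.\<close>
    have "e * det2 (shadow (p k)) (shadow (v k)) \<ge> 0" for k
      using mem[of k]
    proof (elim disjE exE)
      fix y assume "(p k, v k) \<in> fiber_circle y"
      then have "e * det2 (shadow (p k)) (shadow (v k)) = (snd (p k) * level (v k) - level (p k) * snd (v k)) * (e * det2 y (B y))"
        and "snd (p k) * level (v k) - level (p k) * snd (v k) > 0"
        by (auto simp: mem_fiber_circle_iff det2_combination)
      then show ?thesis using sign[of y] by (metis less_imp_le mult_nonneg_nonneg)
    qed (simp add: mem_horizon_iff[OF e])
    moreover have "(\<lambda>k. e * det2 (shadow (p k)) (shadow (v k))) \<longlonglongrightarrow> e * det2 (shadow p0) (shadow v0)"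
      unfolding det2_def by (intro tendsto_intros p v)
    ultimately have ge: "e * det2 (shadow p0) (shadow v0) \<ge> 0"
      by (intro tendsto_lowerbound[where f = "\<lambda>k. e * det2 (shadow (p k)) (shadow (v k))"]) auto
    \<comment> \<open>In the plane of the horizon \<open>shadow\<close> is isometric, so the limit
      shadows are orthonormal and their determinant is not 0.\<close>
    have eq: "p0 = (lin (shadow p0, 0), 0)" "v0 = (lin (shadow v0, 0), 0)"
      using True assemble_parts[of p0] assemble_parts[of v0] by (simp_all add: assemble_def)
    have "norm p0 = norm (shadow p0)" "norm v0 = norm (shadow v0)" "p0 \<bullet> v0 = shadow p0 \<bullet> shadow v0"
      using arg_cong[OF eq(1), of norm] arg_cong[OF eq(2), of norm] arg_cong2[OF eq, of inner]
      by (simp_all add: norm_Pair inner_lin)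
    then have "det2 (shadow p0) (shadow v0) \<noteq> 0" using orth by (intro det2_orthonormal) simp_all
    then have "e * det2 (shadow p0) (shadow v0) > 0" using ge e by auto
    then show ?thesis using True orth by (simp add: l mem_horizon_iff[OF e])
  next
    case False
    \<comment> \<open>Only the velocity may have a limit off the horizon plane;
      \<open>feet_converge\<close> applies to whichever of the two sequences does.\<close>
    then obtain q q0 where q: "q = p \<and> q0 = p0 \<or> q = v \<and> q0 = v0" and nz: "snd q0 \<noteq> 0 \<or> level q0 \<noteq> 0" by blast
    have qlim: "q \<longlonglongrightarrow> q0" using q p v by auto
    define y where "y k = (SOME y. (p k, v k) \<in> fiber_circle y)" for k
    have "eventually (\<lambda>k. snd (q k) \<noteq> 0 \<or> level (q k) \<noteq> 0) sequentially"
      using nz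
    proof
      assume "snd q0 \<noteq> 0"
      then have "eventually (\<lambda>k. snd (q k) \<noteq> 0) sequentially"
        using tendsto_imp_eventually_ne[OF tendsto_snd[OF qlim]] by blast
      then show ?thesis by (rule eventually_mono) simp
    next
      assume "level q0 \<noteq> 0"
      then have "eventually (\<lambda>k. level (q k) \<noteq> 0) sequentially"
        using tendsto_imp_eventually_ne[OF tendsto_level[OF qlim]] by blast
      then show ?thesis by (rule eventually_mono) simp
    qed
    then have ev: "eventually (\<lambda>k. (p k, v k) \<in> fiber_circle (y k)) sequentially"
    proof eventually_elim
      case (elim k)
      then have "(p k, v k) \<notin> horizon e" using q by (auto simp: mem_horizon_iff[OF e])
      then show ?case using mem[of k] unfolding y_def by (metis someI_ex)
    qed
    then have "eventually (\<lambda>k. shadow (q k) = snd (q k) *\<^sub>R y k + level (q k) *\<^sub>R B (y k)) sequentially"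
      by (rule eventually_mono) (use q in \<open>auto simp: mem_fiber_circle_iff\<close>)
    then obtain y0 where "y \<longlonglongrightarrow> y0" using feet_converge[OF surj qlim nz] by blast
    then have "(p0, v0) \<in> fiber_circle y0" using limit_in_fiber_circle p v ev orth by blast
    then show ?thesis by (auto simp: l)
  qed
qed

lemma corresponds_if_surj:
  assumes surj: "surj B" and "B 0 = 0"
  shows "corresponds_to_great_circle_fibration (range (graph_line Phi B))"
proof -
  obtain e :: real where e: "e = 1 \<or> e = -1" and sign: "\<And>y. e * det2 y (B y) \<ge> 0"
    using det2_B_constant_sign assms by blast
  define F where "F = insert (horizon e) (range fiber_circle)"
  have great: "F \<subseteq> oriented_great_circles"
    using horizon_great[OF e] fiber_circle_great by (auto simp: F_def)
  have disj: "circle_points C \<inter> circle_points D = {}" if CD: "C \<in> F" "D \<in> F" "C \<noteq> D" for C D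
  proof (cases "C = horizon e")
    case True
    then obtain y where "D = fiber_circle y" using CD by (auto simp: F_def)
    then show ?thesis using circles_disjoint(2)[OF e, of y] True by (simp add: Int_commute)
  next
    case False
    then obtain y where y: "C = fiber_circle y" using CD by (auto simp: F_def)
    show ?thesis
    proof (cases "D = horizon e")
      case True
      then show ?thesis using circles_disjoint(2)[OF e, of y] y by simp
    next
      case False
      then obtain z where "D = fiber_circle z" using CD by (auto simp: F_def)
      then show ?thesis using circles_disjoint(1)[of y z] y CD(3) by auto
    qed
  qed
  have cover: "\<exists>C\<in>F. p \<in> circle_points C" if "p \<in> sphere 0 1" for p
  proof -
    have n: "norm p = 1" using that by simp
    \<comment> \<open>Points off the equator are covered through \<open>flow\<close>, equatorial
      points off the horizon through surjectivity of \<open>B\<close>, the rest by the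
      horizon.\<close>
    consider "snd p \<noteq> 0" | "snd p = 0" "level p \<noteq> 0" | "snd p = 0" "level p = 0" by blast
    then have "p \<in> circle_points (horizon e) \<or> (\<exists>y. p \<in> circle_points (fiber_circle y))"
    proof cases
      case 1
      obtain z where z: "flow z = ((1 / snd p) *\<^sub>R shadow p, level p / snd p)" using bij_flow by (metis bij_pointE)
      have "snd z = level p / snd p" "snd z *\<^sub>R B (fst z) + fst z = (1 / snd p) *\<^sub>R shadow p"
        using arg_cong[OF z, of snd] arg_cong[OF z, of fst] by (simp_all add: flow_def)
      then have "snd p *\<^sub>R ((level p / snd p) *\<^sub>R B (fst z) + fst z) = snd p *\<^sub>R ((1 / snd p) *\<^sub>R shadow p)" by metis
      then have "shadow p = snd p *\<^sub>R fst z + level p *\<^sub>R B (fst z)"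
        using 1 by (simp add: scaleR_add_right add.commute)
      then show ?thesis using n by (auto simp: fiber_circle_points_iff)
    next
      case 2
      obtain y where "B y = (1 / level p) *\<^sub>R shadow p" using surj by (metis surjD)
      then have "shadow p = snd p *\<^sub>R y + level p *\<^sub>R B y" using 2 by simp
      then show ?thesis using n by (auto simp: fiber_circle_points_iff)
    next
      case 3
      then show ?thesis using n by (simp add: horizon_points_iff[OF e])
    qed
    then show ?thesis by (auto simp: F_def)
  qed
  have velocity: "circle_velocity F p = v" if "(p, v) \<in> \<Union>F" for p v
    using circle_velocity_eq[OF great disj that] .
  have lift: "\<exists>v. (p, v) \<in> \<Union>F \<and> norm v = 1" if "p \<in> sphere 0 1" for p
  proof -
    obtain C where C: "C \<in> F" "p \<in> circle_points C" using cover \<open>p \<in> sphere 0 1\<close> by blast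
    then obtain v where "(p, v) \<in> C" by (auto simp: circle_points_def)
    then show ?thesis using great_circle_rebase(3)[of C p v] C great by blast
  qed
  have "continuous_on (sphere 0 1) (circle_velocity F)"
  proof (rule continuous_from_closed_graph)
    show "compact (sphere (0 :: (real^3) \<times> real) 1)" by simp
    show "circle_velocity F \<in> sphere 0 1 \<rightarrow> sphere 0 1"
    proof
      fix p :: "(real^3) \<times> real" assume "p \<in> sphere 0 1"
      then obtain v where "(p, v) \<in> \<Union>F" "norm v = 1" using lift by blast
      then show "circle_velocity F p \<in> sphere 0 1" using velocity by simp
    qed
    \<comment> \<open>With circles encoded by their lifts, the graph of the velocity is the union of
      \<open>F\<close>; being closed, with values in a compact sphere, it yields continuity.\<close>
    have "(\<lambda>p. (p, circle_velocity F p)) ` sphere 0 1 = \<Union>F"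
    proof (intro equalityI subsetI)
      fix x assume "x \<in> (\<lambda>p. (p, circle_velocity F p)) ` sphere 0 1"
      then obtain p where p: "p \<in> sphere 0 1" "x = (p, circle_velocity F p)" by blast
      then obtain v where "(p, v) \<in> \<Union>F" using lift by blast
      then show "x \<in> \<Union>F" using velocity p by simp
    next
      fix x assume x: "x \<in> \<Union>F"
      obtain p v where pv: "x = (p, v)" by (rule prod.exhaust)
      then have "norm p = 1" using x great great_circle_rebase(2) by blast
      moreover have "x = (p, circle_velocity F p)" using velocity x pv by simp
      ultimately show "x \<in> (\<lambda>p. (p, circle_velocity F p)) ` sphere 0 1" by (intro image_eqI[of _ _ p]) simp_all
    qed
    then show "closed ((\<lambda>p. (p, circle_velocity F p)) ` sphere 0 1)"
      using closed_union_of_circles[OF surj e sign] by (simp add: F_def)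
  qed
  then have "great_circle_fibration F"
    using great cover disj by (simp add: great_circle_fibration_def)
  moreover have "range (graph_line Phi B) = {l. \<exists>C\<in>F. \<not> circle_points C \<subseteq> equator \<and> central_image C l}"
    using central_image_fiber_circle horizon_in_equator[OF e] by (auto simp: F_def)
  ultimately show ?thesis unfolding corresponds_to_great_circle_fibration_def by blast
qed

text \<open>For a given slope \<open>b\<close> with unit direction \<open>q\<close>, the circle of
  \<open>F\<close> through \<open>(q, 0)\<close> must leave the equator; its image is then a graph
  of direction \<open>q\<close> or \<open>- q\<close>, hence of slope \<open>b\<close>.\<close>

lemma surj_if_corresponds:
  assumes "corresponds_to_great_circle_fibration (range (graph_line Phi B))"
  shows "surj B"
proof -
  obtain F where F: "great_circle_fibration F"
    and M: "range (graph_line Phi B) = {l. \<exists>C\<in>F. \<not> circle_points C \<subseteq> equator \<and> central_image C l}"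
    using assms unfolding corresponds_to_great_circle_fibration_def by blast
  have great: "F \<subseteq> oriented_great_circles" and cover: "\<And>p. p \<in> sphere 0 1 \<Longrightarrow> \<exists>C\<in>F. p \<in> circle_points C"
    and disj: "\<And>C D. C \<in> F \<Longrightarrow> D \<in> F \<Longrightarrow> C \<noteq> D \<Longrightarrow> circle_points C \<inter> circle_points D = {}"
    using F by (auto simp: great_circle_fibration_def)
  have through: "\<exists>C v0 s. C \<in> F \<and> C = unit_circle_lift (q, 0) (v0, s) \<and> norm (v0, s) = 1 \<and> q \<bullet> v0 = 0 \<and>
      (s \<noteq> 0 \<longrightarrow> (\<exists>y. - sgn s *\<^sub>R q = sgn (lin (B y, 1))))" if q: "norm q = 1" for q
  proof -
    have "(q, 0 :: real) \<in> sphere 0 1" using q by (simp add: norm_Pair)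
    then obtain C where C: "C \<in> F" "(q, 0) \<in> circle_points C" using cover by blast
    then obtain v' where "((q, 0), v') \<in> C" by (auto simp: circle_points_def)
    then obtain v0 s where v: "((q, 0), (v0, s)) \<in> C" by (metis surj_pair)
    have *: "C = unit_circle_lift (q, 0) (v0, s)" "norm (v0, s) = 1" "q \<bullet> v0 = 0"
      using great_circle_rebase[OF _ v] C great by auto
    have "\<exists>y. - sgn s *\<^sub>R q = sgn (lin (B y, 1))" if "s \<noteq> 0"
    proof -
      have "(range (\<lambda>t. v0 /\<^sub>R s + t *\<^sub>R q), - sgn s *\<^sub>R q) \<in> range (graph_line Phi B)"
        unfolding M using central_image_iff[OF q *(2,3) that] C(1) *(1) by blast
      then show ?thesis by (auto simp: graph_line_eq)
    qed
    then show ?thesis using * C(1) by blast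
  qed
  have positive: "sgn (lin (B y, 1)) \<bullet> n > 0" for y
    using lin_nonzero[of "B y"] by (simp add: sgn_div_norm zero_prod_def)
  have "\<exists>y. b = B y" for b
  proof -
    define q where "q = sgn (lin (b, 1))"
    have q: "norm q = 1" "q \<bullet> n > 0"
      using lin_nonzero[of b] by (simp_all add: q_def norm_sgn sgn_div_norm zero_prod_def)
    obtain C v0 s where C: "C \<in> F" "C = unit_circle_lift (q, 0) (v0, s)" "norm (v0, s) = 1" "q \<bullet> v0 = 0"
      and image: "s \<noteq> 0 \<Longrightarrow> \<exists>y. - sgn s *\<^sub>R q = sgn (lin (B y, 1))"
      using through[OF q(1)] by blast
    have "s \<noteq> 0"
    proof
      assume "s = 0"
      then have v0: "norm v0 = 1" using C(3) by (simp add: norm_Pair)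
      \<comment> \<open>The circle \<open>C\<close> is equatorial, and so is the fiber \<open>C'\<close> through a horizontal \<open>r'\<close>
        orthogonal to the horizontal direction \<open>r\<close> of \<open>C\<close>; they meet, hence coincide.\<close>
      define w where "w = (q \<bullet> n) *\<^sub>R v0 - (v0 \<bullet> n) *\<^sub>R q"
      define r where "r = sgn w"
      have "w \<bullet> v0 \<noteq> 0"
        using q v0 C(4) by (simp add: w_def inner_diff_left norm_eq_1)
      then have "w \<noteq> 0" by auto
      moreover have "w \<bullet> n = 0" by (simp add: w_def inner_diff_left)
      ultimately have r: "norm r = 1" "r \<bullet> n = 0"
        by (simp_all add: r_def norm_sgn) (simp add: sgn_div_norm)
      obtain r' where r': "norm r' = 1" "r \<bullet> r' = 0" "n \<bullet> r' = 0"
        using orthogonal_complement_pair[OF r(1) unit(3) r(2)] by blast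
      obtain C' v' s' where C': "C' \<in> F" "C' = unit_circle_lift (r', 0) (v', s')" "norm (v', s') = 1" "r' \<bullet> v' = 0"
        and image': "s' \<noteq> 0 \<Longrightarrow> \<exists>y. - sgn s' *\<^sub>R r' = sgn (lin (B y, 1))"
        using through[OF r'(1)] by blast
      \<comment> \<open>A circle crossing the equator at \<open>(r', 0)\<close> would project to a
        graph with horizontal direction.\<close>
      have "s' = 0"
      proof (rule ccontr)
        assume "s' \<noteq> 0"
        then obtain y where "- sgn s' *\<^sub>R r' = sgn (lin (B y, 1))" using image' by blast
        then have "(- sgn s' *\<^sub>R r') \<bullet> n > 0" using positive by simp
        then show False using r'(3) by (simp add: inner_commute)
      qed
      then have v': "norm v' = 1" using C'(3) by (simp add: norm_Pair)
      \<comment> \<open>\<open>m\<close> is normal to the plane of \<open>C\<close> inside the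
        hyperplane of the equator.\<close>
      obtain m where m: "norm m = 1" "q \<bullet> m = 0" "v0 \<bullet> m = 0"
        using orthogonal_complement_pair[OF q(1) v0 C(4)] by blast
      have in_C: "(z, 0) \<in> circle_points C" if z: "norm z = 1" "z \<bullet> m = 0" for z
      proof -
        have "z = (z \<bullet> q) *\<^sub>R q + (z \<bullet> v0) *\<^sub>R v0"
          using orthonormal_expansion[OF q(1) v0 m(1) C(4) m(2,3), of z] z(2) by simp
        then have eq: "(z \<bullet> q) *\<^sub>R (q, 0) + (z \<bullet> v0) *\<^sub>R (v0, s) = (z, 0 :: real)" using \<open>s = 0\<close> by simp
        have "norm (z, 0 :: real) = 1" "norm (q, 0 :: real) = 1" "(q, 0) \<bullet> (v0, s) = 0"
          using z q C(4) by (simp_all add: norm_Pair)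
        then show ?thesis
          using unit_combination_in_circle[of "(q, 0)" "(v0, s)" "z \<bullet> q" "z \<bullet> v0"] C(3)
          unfolding eq C(2) by blast
      qed
      \<comment> \<open>The planes of \<open>C\<close> and \<open>C'\<close> lie in a common
        3-space, so they share a unit vector; it is found in the span of \<open>r'\<close>,
        \<open>v'\<close> by imposing orthogonality to \<open>m\<close>.\<close>
      have "\<exists>c d. norm (c *\<^sub>R r' + d *\<^sub>R v') = 1 \<and> (c *\<^sub>R r' + d *\<^sub>R v') \<bullet> m = 0"
      proof (cases "r' \<bullet> m = 0")
        case True
        then show ?thesis using r'(1) by (intro exI[of _ 1] exI[of _ 0]) simp
      next
        case False
        define w' where "w' = - (v' \<bullet> m) *\<^sub>R r' + (r' \<bullet> m) *\<^sub>R v'"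
        have "w' \<bullet> v' = r' \<bullet> m" using v' C'(4) by (simp add: w'_def inner_add_left inner_diff_left norm_eq_1)
        then have "w' \<noteq> 0" using False by auto
        then have "norm (sgn w') = 1" by (simp add: norm_sgn)
        moreover have "w' \<bullet> m = 0" by (simp add: w'_def inner_add_left inner_diff_left)
        then have "sgn w' \<bullet> m = 0" by (simp add: sgn_div_norm)
        moreover have "sgn w' = (- (v' \<bullet> m) / norm w') *\<^sub>R r' + ((r' \<bullet> m) / norm w') *\<^sub>R v'"
        proof -
          have "sgn w' = inverse (norm w') *\<^sub>R (- (v' \<bullet> m) *\<^sub>R r' + (r' \<bullet> m) *\<^sub>R v')"
            unfolding sgn_div_norm using w'_def by (rule arg_cong)
          then show ?thesis by (simp add: scaleR_add_right scaleR_diff_right divide_inverse_commute)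
        qed
        ultimately show ?thesis by metis
      qed
      then obtain c d where z: "norm (c *\<^sub>R r' + d *\<^sub>R v') = 1" "(c *\<^sub>R r' + d *\<^sub>R v') \<bullet> m = 0" by blast
      have "(c *\<^sub>R r' + d *\<^sub>R v', 0) \<in> circle_points C'"
        using unit_combination_in_circle[of "(r', 0::real)" "(v', s')" c d] r' v' z C' \<open>s' = 0\<close>
        by (simp add: norm_Pair)
      then have "C = C'" using in_C[OF z] disj C(1) C'(1) by blast
      \<comment> \<open>Once \<open>C = C'\<close>, both horizontal vectors \<open>r\<close> and
        \<open>r'\<close> are orthogonal to \<open>m\<close>, so \<open>m\<close> is a multiple of
        \<open>n\<close>; this contradicts \<open>q \<bullet> m = 0\<close> and
        \<open>q \<bullet> n > 0\<close>.\<close>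
      have "r' \<bullet> m = 0"
      proof -
        have "(1 *\<^sub>R r' + 0 *\<^sub>R v', 0 :: real) \<in> circle_points C'"
          using unit_combination_in_circle[of "(r', 0::real)" "(v', s')" 1 0] r' v' C' \<open>s' = 0\<close>
          by (simp add: norm_Pair)
        then have "(r', 0 :: real) \<in> circle_points (unit_circle_lift (q, 0) (v0, s))"
          using \<open>C = C'\<close> C(2) by simp
        then obtain c d where "(r', 0 :: real) = c *\<^sub>R (q, 0) + d *\<^sub>R (v0, s)" by (rule circle_pointsE)
        then show ?thesis using m by (simp add: inner_add_left)
      qed
      moreover have "r \<bullet> m = 0" using m by (simp add: r_def w_def sgn_div_norm inner_diff_left)
      ultimately have "m = (m \<bullet> n) *\<^sub>R n"
        using orthonormal_expansion[OF r(1) r'(1) unit(3) r'(2) r(2), of m] r'(3) by (simp add: inner_commute)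
      moreover from this have "m \<bullet> n \<noteq> 0" using m(1) by auto
      ultimately have "(m \<bullet> n) * (q \<bullet> n) = 0" using m(2) by (metis inner_scaleR_right)
      then show False using q \<open>m \<bullet> n \<noteq> 0\<close> by simp
    qed
    then obtain y where y: "- sgn s *\<^sub>R q = sgn (lin (B y, 1))" using image by blast
    then have "q = sgn (lin (B y, 1)) \<or> q = - sgn (lin (B y, 1))"
    proof -
      have "q = sgn (lin (B y, 1)) \<or> - q = sgn (lin (B y, 1))"
        using \<open>s \<noteq> 0\<close> y by (auto simp: sgn_if split: if_splits)
      then show ?thesis by (metis minus_minus)
    qed
    then show ?thesis using sgn_lin_eqD[of b "B y"] by (auto simp: q_def)
  qed
  then show ?thesis by (simp add: surj_def)
qed

end

theorem theorem2:
  fixes M :: "oriented_line set"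
  assumes "M \<subseteq> oriented_lines"
  shows "(skew_line_fibration M \<longleftrightarrow> (\<exists>\<Phi> B. graph_presentation M \<Phi> B)) \<and>
    (\<forall>\<Phi> B. skew_line_fibration M \<and> graph_presentation M \<Phi> B \<longrightarrow>
       (corresponds_to_great_circle_fibration M \<longleftrightarrow> surj B))"
proof (intro conjI allI impI)
  show "skew_line_fibration M \<longleftrightarrow> (\<exists>\<Phi> B. graph_presentation M \<Phi> B)"
    using graph_presentation_imp_skew_line_fibration skew_line_fibration_imp_graph_presentation by metis
next
  fix \<Phi> B assume "skew_line_fibration M \<and> graph_presentation M \<Phi> B"
  then obtain a e1 e2 n where *: "skew_graph_family e1 e2 n B" "\<Phi> = orthonormal_frame.Phi a e1 e2 n"
      "M = range (graph_line \<Phi> B)" "B 0 = 0"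
    using graph_presentationE by metis
  interpret skew_graph_family a e1 e2 n B by (rule *(1))
  show "corresponds_to_great_circle_fibration M \<longleftrightarrow> surj B"
    using corresponds_if_surj surj_if_corresponds * by metis
qed

end
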